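(* Let $S\subset\mathbb R^n$ be a closed subset. For each $T\in Ext\bigl(C_b^{k,\omega}(S);C_b^{k,\omega}(\mathbb R^n)\bigr)$ of finite depth there exists a bounded linear projection $P:G_b^{k,\omega}(\mathbb R^n)\to G_b^{k,\omega}(S)$ (onto $G_b^{k,\omega}(S)$) whose adjoint is $P^*=T$.
   Context: Let $n\in\mathbb N$, $k\in\mathbb Z_+$, and let $\omega:(0,\infty)\to(0,\infty)$ be a modulus of continuity, meaning that (i) $\omega(t)$ and $t/\omega(t)$ are nondecreasing on $(0,\infty)$, and (ii) $\lim_{t\to0^+}\omega(t)=0$. All functions are real-valued and $\|\cdot\|$ on $\mathbb R^n$ is the Euclidean norm. $C_b^{k,\omega}(\mathbb R^n)$ is the Banach space of $f\in C^k(\mathbb R^n)$ with finite norm $\|f\|_{C_b^{k,\omega}(\mathbb R^n)}:=\max\bigl(\|f\|_{C_b^k(\mathbb R^n)},|f|_{C_b^{k,\omega}(\mathbb R^n)}\bigr)$, where $\|f\|_{C_b^k(\mathbb R^n)}:=\max_{|\alpha|\le k}\sup_{x}|D^\alpha f(x)|$ and $|f|_{C_b^{k,\omega}(\mathbb R^n)}:=\max_{|\alpha|=k}\sup_{x\neq y}\frac{|D^\alpha f(x)-D^\alpha f(y)|}{\omega(\|x-y\|)}$. For closed $S\subset\mathbb R^n$, $C_b^{k,\omega}(S)$ is the space of restrictions $f|_S$, $f\in C_b^{k,\omega}(\mathbb R^n)$, with the quotient norm $\|g\|_{C_b^{k,\omega}(S)}:=\inf\{\|\tilde g\|_{C_b^{k,\omega}(\mathbb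 R^n)}:\tilde g|_S=g\}$. For $x\in\mathbb R^n$, $\delta_x^0\in\bigl(C_b^{k,\omega}(\mathbb R^n)\bigr)^*$ is evaluation at $x$. $G_b^{k,\omega}(S)\subset\bigl(C_b^{k,\omega}(\mathbb R^n)\bigr)^*$ is the minimal closed subspace containing all $\delta_x^0$, $x\in S$. The dual $\bigl(G_b^{k,\omega}(S)\bigr)^*$ is identified with $C_b^{k,\omega}(S)$ via the isometric isomorphism $h\mapsto(s\mapsto h(\delta_s^0))$ (for every closed $S$, including $S=\mathbb R^n$). $Ext\bigl(C_b^{k,\omega}(S);C_b^{k,\omega}(\mathbb R^n)\bigr)$ is the set of bounded linear operators $T:C_b^{k,\omega}(S)\to C_b^{k,\omega}(\mathbb R^n)$ with $(Tf)|_S=f$ for all $f$. Such $T$ has depth $d\in\mathbb N$ if for all $x\in\mathbb R^n$ and $f\in C_b^{k,\omega}(S)$ one has $(Tf)(x)=\sum_{i=1}^d\lambda_i^x f(y_i^x)$, where $y_i^x\in S$ and $\lambda_i^x\in\mathbb R$ depend only on $x$; $T$ has finite depth if it has depth $d$ for some $d\in\mathbb N$. *)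

theory Defs
  imports "HOL-Analysis.Analysis" "HOL-Library.Function_Algebras"
begin

instantiation "fun" :: (type, real_vector) real_vector
begin

definition "c *\<^sub>R f = (\<lambda>x. c *\<^sub>R f x)"

instance
  by standard (simp_all add: scaleR_fun_def fun_eq_iff scaleR_add_right scaleR_add_left)

end

text \<open>
  A normed space is given by a carrier set and a norm function. Elements of function spaces over a
  proper subset are total functions that are 0 outside it, so that two such elements are equal iff
  they agree on the subset. The same convention is used for bounded functionals.
\<close>

definition bounded_linear_between ::
  "'a::real_vector set \<Rightarrow> ('a \<Rightarrow> real) \<Rightarrow> 'b::real_vector set \<Rightarrow> ('b \<Rightarrow> real) \<Rightarrow> ('a \<Rightarrow> 'b) \<Rightarrow> bool" where
  "bounded_linear_between V N W M T \<longleftrightarrow>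
     (\<forall>f\<in>V. T f \<in> W) \<and>
     (\<forall>f\<in>V. \<forall>g\<in>V. T (f + g) = T f + T g) \<and>
     (\<forall>c. \<forall>f\<in>V. T (c *\<^sub>R f) = c *\<^sub>R T f) \<and>
     (\<exists>B. \<forall>f\<in>V. M (T f) \<le> B * N f)"

definition dual_space :: "'a::real_vector set \<Rightarrow> ('a \<Rightarrow> real) \<Rightarrow> ('a \<Rightarrow> real) set" where
  "dual_space V N = {\<phi>. bounded_linear_between V N UNIV abs \<phi> \<and> (\<forall>f. f \<notin> V \<longrightarrow> \<phi> f = 0)}"

definition dual_norm :: "'a::real_vector set \<Rightarrow> ('a \<Rightarrow> real) \<Rightarrow> ('a \<Rightarrow> real) \<Rightarrow> real" where
  "dual_norm V N \<phi> = Sup {\<bar>\<phi> f\<bar> | f. f \<in> V \<and> N f \<le> 1}"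

definition closed_subspace_of ::
  "'a::real_vector set \<Rightarrow> 'a set \<Rightarrow> ('a \<Rightarrow> real) \<Rightarrow> bool" where
  "closed_subspace_of U V N \<longleftrightarrow> U \<subseteq> V \<and> subspace U \<and>
     (\<forall>u v. (\<forall>j::nat. u j \<in> U) \<and> v \<in> V \<and> (\<lambda>j. N (u j - v)) \<longlonglongrightarrow> 0 \<longrightarrow> v \<in> U)"

definition bounded_linear_projection_onto ::
  "'a::real_vector set \<Rightarrow> 'a set \<Rightarrow> ('a \<Rightarrow> real) \<Rightarrow> ('a \<Rightarrow> 'a) \<Rightarrow> bool" where
  "bounded_linear_projection_onto V W N P \<longleftrightarrow>
     bounded_linear_between V N W N P \<and> P ` V = W \<and> (\<forall>v\<in>V. P (P v) = P v)"

definition adjoint_on :: "'a set \<Rightarrow> ('a \<Rightarrow> 'b) \<Rightarrow> ('b \<Rightarrow> real) \<Rightarrow> 'a \<Rightarrow> real" where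
  "adjoint_on V P h = (\<lambda>v. if v \<in> V then h (P v) else 0)"

definition restrict0 :: "'a set \<Rightarrow> ('a \<Rightarrow> real) \<Rightarrow> 'a \<Rightarrow> real" where
  "restrict0 S f = (\<lambda>x. if x \<in> S then f x else 0)"


definition modulus_of_continuity :: "(real \<Rightarrow> real) \<Rightarrow> bool" where
  "modulus_of_continuity \<omega> \<longleftrightarrow>
     (\<forall>t>0. \<omega> t > 0) \<and> mono_on {0<..} \<omega> \<and> mono_on {0<..} (\<lambda>t. t / \<omega> t) \<and>
     (\<omega> \<longlongrightarrow> 0) (at_right 0)"

definition partial :: "'n \<Rightarrow> (real^'n \<Rightarrow> real) \<Rightarrow> real^'n \<Rightarrow> real" where
  "partial i f x = deriv (\<lambda>t. f (x + t *\<^sub>R axis i 1)) 0"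

primrec Ck :: "nat \<Rightarrow> (real^'n \<Rightarrow> real) \<Rightarrow> bool" where
  "Ck 0 f \<longleftrightarrow> continuous_on UNIV f"
| "Ck (Suc k) f \<longleftrightarrow> continuous_on UNIV f \<and>
     (\<forall>i. (\<forall>x. (\<lambda>t. f (x + t *\<^sub>R axis i 1)) differentiable (at 0)) \<and> Ck k (partial i f))"

text \<open>
  Multi-indices are functions \<open>'n \<Rightarrow> nat\<close>. The coordinates of the index type carry no order; the
  partial derivatives in \<open>D\<^sup>\<alpha>\<close> are taken along one fixed enumeration of the coordinates, which is
  immaterial for \<open>C\<^sup>k\<close> functions and \<open>\<bar>\<alpha>\<bar> \<le> k\<close>.
\<close>

definition mi_order :: "('n::finite \<Rightarrow> nat) \<Rightarrow> nat" where
  "mi_order \<alpha> = (\<Sum>i\<in>UNIV. \<alpha> i)"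

definition mi_deriv :: "('n::finite \<Rightarrow> nat) \<Rightarrow> (real^'n \<Rightarrow> real) \<Rightarrow> real^'n \<Rightarrow> real" where
  "mi_deriv \<alpha> f = fold (\<lambda>i. partial i ^^ \<alpha> i) (SOME xs. distinct xs \<and> set xs = UNIV) f"

text \<open>Extended-valued norms; the suprema over multi-indices range over finite nonempty sets.\<close>

definition Cbk_enorm :: "nat \<Rightarrow> (real^'n \<Rightarrow> real) \<Rightarrow> ereal" where
  "Cbk_enorm k f = (SUP \<alpha>\<in>{\<alpha>. mi_order \<alpha> \<le> k}. SUP x. ereal \<bar>mi_deriv \<alpha> f x\<bar>)"

definition Cbkw_eseminorm :: "nat \<Rightarrow> (real \<Rightarrow> real) \<Rightarrow> (real^'n \<Rightarrow> real) \<Rightarrow> ereal" where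
  "Cbkw_eseminorm k \<omega> f = (SUP \<alpha>\<in>{\<alpha>. mi_order \<alpha> = k}. SUP (x, y)\<in>{(x, y). x \<noteq> y}.
     ereal (\<bar>mi_deriv \<alpha> f x - mi_deriv \<alpha> f y\<bar> / \<omega> (norm (x - y))))"

definition Cbkw_enorm :: "nat \<Rightarrow> (real \<Rightarrow> real) \<Rightarrow> (real^'n \<Rightarrow> real) \<Rightarrow> ereal" where
  "Cbkw_enorm k \<omega> f = max (Cbk_enorm k f) (Cbkw_eseminorm k \<omega> f)"

definition Cbkw :: "nat \<Rightarrow> (real \<Rightarrow> real) \<Rightarrow> (real^'n \<Rightarrow> real) set" where
  "Cbkw k \<omega> = {f. Ck k f \<and> Cbkw_enorm k \<omega> f < \<infinity>}"

definition Cbkw_norm :: "nat \<Rightarrow> (real \<Rightarrow> real) \<Rightarrow> (real^'n \<Rightarrow> real) \<Rightarrow> real" where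
  "Cbkw_norm k \<omega> f = real_of_ereal (Cbkw_enorm k \<omega> f)"

definition Cbkw_on :: "nat \<Rightarrow> (real \<Rightarrow> real) \<Rightarrow> (real^'n) set \<Rightarrow> (real^'n \<Rightarrow> real) set" where
  "Cbkw_on k \<omega> S = restrict0 S ` Cbkw k \<omega>"

definition Cbkw_on_norm ::
  "nat \<Rightarrow> (real \<Rightarrow> real) \<Rightarrow> (real^'n) set \<Rightarrow> (real^'n \<Rightarrow> real) \<Rightarrow> real" where
  "Cbkw_on_norm k \<omega> S g = Inf {Cbkw_norm k \<omega> f | f. f \<in> Cbkw k \<omega> \<and> restrict0 S f = g}"

abbreviation Cbkw_dual :: "nat \<Rightarrow> (real \<Rightarrow> real) \<Rightarrow> ((real^'n \<Rightarrow> real) \<Rightarrow> real) set" where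
  "Cbkw_dual k \<omega> \<equiv> dual_space (Cbkw k \<omega>) (Cbkw_norm k \<omega>)"

abbreviation Cbkw_dual_norm ::
  "nat \<Rightarrow> (real \<Rightarrow> real) \<Rightarrow> ((real^'n \<Rightarrow> real) \<Rightarrow> real) \<Rightarrow> real" where
  "Cbkw_dual_norm k \<omega> \<equiv> dual_norm (Cbkw k \<omega>) (Cbkw_norm k \<omega>)"

definition point_eval :: "nat \<Rightarrow> (real \<Rightarrow> real) \<Rightarrow> real^'n \<Rightarrow> (real^'n \<Rightarrow> real) \<Rightarrow> real" where
  "point_eval k \<omega> x = (\<lambda>f. if f \<in> Cbkw k \<omega> then f x else 0)"

definition Gbkw ::
  "nat \<Rightarrow> (real \<Rightarrow> real) \<Rightarrow> (real^'n) set \<Rightarrow> ((real^'n \<Rightarrow> real) \<Rightarrow> real) set" where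
  "Gbkw k \<omega> S = \<Inter>{U. closed_subspace_of U (Cbkw_dual k \<omega>) (Cbkw_dual_norm k \<omega>) \<and>
                       point_eval k \<omega> ` S \<subseteq> U}"

text \<open>The identification of the dual of \<^term>\<open>Gbkw k \<omega> S\<close> with \<^term>\<open>Cbkw_on k \<omega> S\<close>.\<close>

definition Gbkw_dual_to_fun ::
  "nat \<Rightarrow> (real \<Rightarrow> real) \<Rightarrow> (real^'n) set \<Rightarrow>
   (((real^'n \<Rightarrow> real) \<Rightarrow> real) \<Rightarrow> real) \<Rightarrow> real^'n \<Rightarrow> real" where
  "Gbkw_dual_to_fun k \<omega> S h = restrict0 S (\<lambda>s. h (point_eval k \<omega> s))"

definition Ext ::
  "nat \<Rightarrow> (real \<Rightarrow> real) \<Rightarrow> (real^'n) set \<Rightarrow> ((real^'n \<Rightarrow> real) \<Rightarrow> real^'n \<Rightarrow> real) set" where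
  "Ext k \<omega> S = {T.
     bounded_linear_between (Cbkw_on k \<omega> S) (Cbkw_on_norm k \<omega> S) (Cbkw k \<omega>) (Cbkw_norm k \<omega>) T \<and>
     (\<forall>f\<in>Cbkw_on k \<omega> S. restrict0 S (T f) = f)}"

definition has_depth ::
  "nat \<Rightarrow> (real \<Rightarrow> real) \<Rightarrow> (real^'n) set \<Rightarrow> ((real^'n \<Rightarrow> real) \<Rightarrow> real^'n \<Rightarrow> real) \<Rightarrow> nat \<Rightarrow> bool" where
  "has_depth k \<omega> S T d \<longleftrightarrow>
     (\<exists>(c :: real^'n \<Rightarrow> nat \<Rightarrow> real) (y :: real^'n \<Rightarrow> nat \<Rightarrow> real^'n).
        (\<forall>x. \<forall>i\<in>{1..d}. y x i \<in> S) \<and>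
        (\<forall>x. \<forall>f\<in>Cbkw_on k \<omega> S. T f x = (\<Sum>i=1..d. c x i * f (y x i))))"

definition finite_depth ::
  "nat \<Rightarrow> (real \<Rightarrow> real) \<Rightarrow> (real^'n) set \<Rightarrow> ((real^'n \<Rightarrow> real) \<Rightarrow> real^'n \<Rightarrow> real) \<Rightarrow> bool" where
  "finite_depth k \<omega> S T \<longleftrightarrow> (\<exists>d\<ge>1. has_depth k \<omega> S T d)"

end

theory Submission
  imports Defs
begin

text \<open>
  Composing \<open>T\<close> with restriction to \<open>S\<close> gives a bounded operator \<open>R\<close> on the function space over the
  whole of \<open>\<real>\<^sup>n\<close>, and \<open>P\<close> is its adjoint \<open>\<phi> \<mapsto> \<phi> \<circ> R\<close>, taken on the predual. Finite depth says exactly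
  that \<open>P\<close> sends the evaluation at \<open>x\<close> to the finite combination of the evaluations at the points
  \<open>y\<^sub>i\<^sup>x \<in> S\<close> with coefficients \<open>\<lambda>\<^sub>i\<^sup>x\<close>; and \<open>P\<close> fixes the evaluations at points of \<open>S\<close> because \<open>T f\<close>
  extends \<open>f\<close>. Both properties pass to closed linear spans by continuity, so \<open>P\<close> is a projection of
  one predual onto the other (\<open>adjoint_projection\<close>).

  For the adjoint, let \<open>h\<close> be a functional on the predual of \<open>S\<close>, and let \<open>g\<close> be the function
  \<open>s \<mapsto> h \<delta>\<^sub>s\<close> on \<open>S\<close>. The value of \<open>h\<close> on \<open>P \<delta>\<^sub>x\<close> is the sum of the \<open>\<lambda>\<^sub>i\<^sup>x g(y\<^sub>i\<^sup>x)\<close>, which is \<open>T g\<close> at \<open>x\<close>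
  as soon as \<open>g\<close> belongs to the domain of \<open>T\<close>. So \<open>g\<close> must be shown to be the restriction of a function in the
  space. The projection itself provides the extension: \<open>h \<circ> P\<close> is a bounded
  functional on the predual of \<open>\<real>\<^sup>n\<close> that extends \<open>h\<close>.

  What remains is that \<open>F x = H \<delta>\<^sub>x\<close> lies in the space for each bounded functional \<open>H\<close> on the predual of
  \<open>\<real>\<^sup>n\<close> (\<open>Gbkw_dual_imp_Cbkw\<close>). The evaluations of derivatives of order at most \<open>k\<close> are bounded
  functionals, and the difference quotients of those of order below \<open>k\<close> converge to the next ones in
  the dual norm, uniformly over the unit ball, at a rate given by the modulus of continuity. Hence
  derivative evaluations lie in the predual, \<open>H\<close> may be differentiated under the evaluation, and the
  bounds on \<open>H\<close> become bounds on the derivatives of \<open>F\<close>. The norm only sees derivatives taken in one fixed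
  order of the coordinates, whereas being \<open>C\<^sup>k\<close> involves all orders; the symmetry of mixed partial
  derivatives (\<open>partial_commute\<close>) connects the two.
\<close>

section \<open>Partial derivatives\<close>

definition partially_differentiable :: "'n \<Rightarrow> (real^'n \<Rightarrow> real) \<Rightarrow> bool" where
  "partially_differentiable i f \<longleftrightarrow> (\<forall>x. (\<lambda>t. f (x + t *\<^sub>R axis i 1)) differentiable (at 0))"

lemma partially_differentiableI:
  assumes "\<And>x. ((\<lambda>t. f (x + t *\<^sub>R axis i 1)) has_real_derivative D x) (at 0)"
  shows "partially_differentiable i f" "partial i f = D"
proof -
  show "partially_differentiable i f"
    unfolding partially_differentiable_def
    using assms real_differentiable_def by blast
  show "partial i f = D"
    unfolding partial_def using assms by (auto intro!: DERIV_imp_deriv)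
qed

lemma partial_has_derivative:
  assumes "partially_differentiable i f"
  shows "((\<lambda>t. f (x + t *\<^sub>R axis i 1)) has_real_derivative partial i f (x + s *\<^sub>R axis i 1)) (at s)"
proof -
  have "(\<lambda>t. f ((x + s *\<^sub>R axis i 1) + t *\<^sub>R axis i 1)) differentiable (at 0)"
    using assms unfolding partially_differentiable_def by blast
  then have "((\<lambda>t. f ((x + s *\<^sub>R axis i 1) + t *\<^sub>R axis i 1)) has_real_derivative
      partial i f (x + s *\<^sub>R axis i 1)) (at 0)"
    unfolding partial_def by (simp add: DERIV_deriv_iff_real_differentiable)
  moreover have "(\<lambda>t. f ((x + s *\<^sub>R axis i 1) + t *\<^sub>R axis i 1)) =
      (\<lambda>t. f (x + (t + s) *\<^sub>R axis i 1))"
    by (simp add: algebra_simps)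
  ultimately show ?thesis
    using DERIV_shift[of "\<lambda>t. f (x + t *\<^sub>R axis i 1)" _ 0 s] by simp
qed

lemma partial_has_derivative_0:
  assumes "partially_differentiable i f"
  shows "((\<lambda>t. f (x + t *\<^sub>R axis i 1)) has_real_derivative partial i f x) (at 0)"
  using partial_has_derivative[OF assms, of x 0] by simp

lemma partial_add:
  assumes "partially_differentiable i f" "partially_differentiable i g"
  shows "partially_differentiable i (f + g)" "partial i (f + g) = partial i f + partial i g"
proof -
  have *: "((\<lambda>t. (f + g) (x + t *\<^sub>R axis i 1)) has_real_derivative (partial i f + partial i g) x) (at 0)" for x
    using assms by (auto simp: plus_fun_def intro!: derivative_intros partial_has_derivative_0)
  show "partially_differentiable i (f + g)" "partial i (f + g) = partial i f + partial i g"
    using partially_differentiableI[OF *] by blast+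
qed

lemma partial_scaleR:
  assumes "partially_differentiable i f"
  shows "partially_differentiable i (c *\<^sub>R f)" "partial i (c *\<^sub>R f) = c *\<^sub>R partial i f"
proof -
  have *: "((\<lambda>t. (c *\<^sub>R f) (x + t *\<^sub>R axis i 1)) has_real_derivative (c *\<^sub>R partial i f) x) (at 0)" for x
    unfolding scaleR_fun_def real_scaleR_def
    by (rule DERIV_cmult) (rule partial_has_derivative_0[OF assms])
  show "partially_differentiable i (c *\<^sub>R f)" "partial i (c *\<^sub>R f) = c *\<^sub>R partial i f"
    using partially_differentiableI[OF *] by blast+
qed

lemma partial_mean_value:
  assumes "partially_differentiable i f"
  obtains s where "\<bar>s\<bar> \<le> \<bar>t\<bar>"
    "f (x + t *\<^sub>R axis i 1) - f x = t * partial i f (x + s *\<^sub>R axis i 1)"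
proof -
  note D = partial_has_derivative[OF assms, of x]
  consider "t = 0" | "t > 0" | "t < 0" by linarith
  then show thesis
  proof cases
    case 1
    then show ?thesis using that[of 0] by simp
  next
    case 2
    then obtain z where "z > 0" "z < t"
      "f (x + t *\<^sub>R axis i 1) - f (x + 0 *\<^sub>R axis i 1) = (t - 0) * partial i f (x + z *\<^sub>R axis i 1)"
      using MVT2[of 0 t "\<lambda>t. f (x + t *\<^sub>R axis i 1)" "\<lambda>t. partial i f (x + t *\<^sub>R axis i 1)"] D by blast
    then show ?thesis using that[of z] by simp
  next
    case 3
    then obtain z where "z > t" "z < 0"
      "f (x + 0 *\<^sub>R axis i 1) - f (x + t *\<^sub>R axis i 1) = (0 - t) * partial i f (x + z *\<^sub>R axis i 1)"
      using MVT2[of t 0 "\<lambda>t. f (x + t *\<^sub>R axis i 1)" "\<lambda>t. partial i f (x + t *\<^sub>R axis i 1)"] D by blast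
    then show ?thesis using that[of z] by simp
  qed
qed

text \<open>
  Change one coordinate at a time: each change costs at most \<open>M\<close> times the change of that coordinate
  by the mean value theorem, and every coordinate changes by at most the norm. The induction is over
  the finite set of coordinates in which the points may differ.
\<close>

lemma bounded_partials_imp_Lipschitz:
  fixes f :: "real^'n \<Rightarrow> real"
  assumes "\<And>i. partially_differentiable i f" and "\<And>i x. \<bar>partial i f x\<bar> \<le> M"
  shows "\<bar>f x - f y\<bar> \<le> M * (CARD('n) * norm (x - y))"
proof -
  have M: "0 \<le> M" using assms(2) by (meson abs_ge_zero order_trans)
  have "\<bar>f x - f y\<bar> \<le> M * (\<Sum>i\<in>A. \<bar>x $ i - y $ i\<bar>)"
    if "finite A" "\<And>i. i \<notin> A \<Longrightarrow> x $ i = y $ i" for A x y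
    using that
  proof (induction A arbitrary: x rule: finite_induct)
    case empty
    then have "x = y" by (simp add: vec_eq_iff)
    then show ?case by simp
  next
    case (insert i A)
    define t where "t = x $ i - y $ i"
    define z where "z = x - t *\<^sub>R axis i 1"
    have z: "z $ j = (if j = i then y $ i else x $ j)" for j
      by (simp add: z_def t_def axis_def)
    have *: "\<bar>f z - f y\<bar> \<le> M * (\<Sum>i\<in>A. \<bar>z $ i - y $ i\<bar>)"
      by (rule insert.IH) (use insert.prems in \<open>auto simp: z\<close>)
    have "(\<Sum>i\<in>A. \<bar>z $ i - y $ i\<bar>) = (\<Sum>i\<in>A. \<bar>x $ i - y $ i\<bar>)"
      using insert.hyps by (intro sum.cong) (auto simp: z)
    moreover obtain s where "f (z + t *\<^sub>R axis i 1) - f z = t * partial i f (z + s *\<^sub>R axis i 1)"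
      using partial_mean_value[OF assms(1)] by metis
    then have "\<bar>f x - f z\<bar> \<le> \<bar>t\<bar> * M"
      unfolding z_def by (simp add: abs_mult mult_left_mono assms(2))
    ultimately show ?case
      using insert.hyps * by (simp add: t_def algebra_simps)
  qed
  from this[of UNIV x y] have "\<bar>f x - f y\<bar> \<le> M * (\<Sum>i\<in>UNIV. \<bar>x $ i - y $ i\<bar>)" by simp
  also have "(\<Sum>i\<in>UNIV. \<bar>x $ i - y $ i\<bar>) \<le> (\<Sum>i\<in>(UNIV::'n set). norm (x - y))"
    by (intro sum_mono) (metis component_le_norm_cart vector_minus_component)
  finally show ?thesis using M by (simp add: mult_left_mono)
qed

text \<open>
  The second difference is the increment in direction \<open>i\<close> of the increment in direction \<open>j\<close>. The mean
  value theorem is applied first along \<open>i\<close> and then along \<open>j\<close>. As the second difference is symmetric in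
  \<open>i\<close> and \<open>j\<close>, its quotient by \<open>h\<^sup>2\<close> is a common value of both mixed derivatives at nearby points.
\<close>

lemma second_difference_mean_value:
  fixes f :: "real^'n \<Rightarrow> real"
  assumes "partially_differentiable i f" "partially_differentiable j (partial i f)"
  obtains z where "norm (z - x) \<le> 2 * \<bar>h\<bar>"
    "f (x + h *\<^sub>R axis i 1 + h *\<^sub>R axis j 1) - f (x + h *\<^sub>R axis i 1) - f (x + h *\<^sub>R axis j 1) + f x
      = h * (h * partial j (partial i f) z)"
proof -
  define g where "g = (\<lambda>u. f (u + h *\<^sub>R axis j 1) - f u)"
  have "((\<lambda>t. g (u + t *\<^sub>R axis i 1)) has_real_derivative
      (partial i f (u + h *\<^sub>R axis j 1) - partial i f u)) (at 0)" for u
  proof -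
    have "(\<lambda>t. g (u + t *\<^sub>R axis i 1)) =
        (\<lambda>t. f ((u + h *\<^sub>R axis j 1) + t *\<^sub>R axis i 1) - f (u + t *\<^sub>R axis i 1))"
      by (simp add: g_def algebra_simps)
    then show ?thesis
      by (simp add: DERIV_diff partial_has_derivative_0[OF assms(1)])
  qed
  note g = partially_differentiableI[OF this]
  obtain s where s: "\<bar>s\<bar> \<le> \<bar>h\<bar>"
      "g (x + h *\<^sub>R axis i 1) - g x = h * partial i g (x + s *\<^sub>R axis i 1)"
    using partial_mean_value[OF g(1)] by blast
  obtain r where r: "\<bar>r\<bar> \<le> \<bar>h\<bar>"
      "partial i f (x + s *\<^sub>R axis i 1 + h *\<^sub>R axis j 1) - partial i f (x + s *\<^sub>R axis i 1) =
       h * partial j (partial i f) (x + s *\<^sub>R axis i 1 + r *\<^sub>R axis j 1)"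
    using partial_mean_value[OF assms(2)] by blast
  show thesis
  proof (rule that)
    have "norm (s *\<^sub>R axis i 1 + r *\<^sub>R axis j 1 :: real^'n) \<le> \<bar>s\<bar> + \<bar>r\<bar>"
      by (rule order_trans[OF norm_triangle_ineq]) simp
    then show "norm (x + s *\<^sub>R axis i 1 + r *\<^sub>R axis j 1 - x) \<le> 2 * \<bar>h\<bar>"
      using s(1) r(1) by (simp add: add.assoc)
    show "f (x + h *\<^sub>R axis i 1 + h *\<^sub>R axis j 1) - f (x + h *\<^sub>R axis i 1) - f (x + h *\<^sub>R axis j 1) + f x
      = h * (h * partial j (partial i f) (x + s *\<^sub>R axis i 1 + r *\<^sub>R axis j 1))"
      using s(2) r(2) by (simp add: g(2)) (simp add: g_def)
  qed
qed

text \<open>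
  Symmetry of second derivatives. For each step size, both mixed derivatives take the same value at
  points within twice the step size of \<open>x\<close>; continuity transfers the equality to \<open>x\<close>.
\<close>

lemma partial_commute:
  fixes f :: "real^'n \<Rightarrow> real"
  assumes "partially_differentiable i f" "partially_differentiable j f"
    and "partially_differentiable j (partial i f)" "partially_differentiable i (partial j f)"
    and "continuous_on UNIV (partial j (partial i f))" "continuous_on UNIV (partial i (partial j f))"
  shows "partial i (partial j f) = partial j (partial i f)"
proof
  fix x
  define h :: "nat \<Rightarrow> real" where "h n = inverse (real (Suc n))" for n
  have "\<exists>z w. norm (z - x) \<le> 2 * h n \<and> norm (w - x) \<le> 2 * h n \<and>
      partial j (partial i f) z = partial i (partial j f) w" for n
  proof -
    have h: "h n > 0" by (simp add: h_def)
    obtain z where z: "norm (z - x) \<le> 2 * \<bar>h n\<bar>"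
    "f (x + h n *\<^sub>R axis i 1 + h n *\<^sub>R axis j 1) - f (x + h n *\<^sub>R axis i 1) - f (x + h n *\<^sub>R axis j 1) + f x
      = h n * (h n * partial j (partial i f) z)"
      using second_difference_mean_value[OF assms(1,3)] .
    obtain w where w: "norm (w - x) \<le> 2 * \<bar>h n\<bar>"
    "f (x + h n *\<^sub>R axis j 1 + h n *\<^sub>R axis i 1) - f (x + h n *\<^sub>R axis j 1) - f (x + h n *\<^sub>R axis i 1) + f x
      = h n * (h n * partial i (partial j f) w)"
      using second_difference_mean_value[OF assms(2,4)] .
    have "h n * (h n * partial j (partial i f) z) = h n * (h n * partial i (partial j f) w)"
      unfolding z(2)[symmetric] w(2)[symmetric] by (simp add: add.commute add.left_commute)
    then show ?thesis using z(1) w(1) h by auto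
  qed
  then obtain z w where z: "\<And>n. norm (z n - x) \<le> 2 * h n" and w: "\<And>n. norm (w n - x) \<le> 2 * h n"
    and eq: "\<And>n. partial j (partial i f) (z n) = partial i (partial j f) (w n)" by metis
  have lim: "u \<longlonglongrightarrow> x" if "\<And>n. norm (u n - x) \<le> 2 * h n" for u
  proof -
    have "(\<lambda>n. 2 * h n) \<longlonglongrightarrow> 2 * 0"
      unfolding h_def by (intro tendsto_intros LIMSEQ_inverse_real_of_nat)
    then have "(\<lambda>n. norm (u n - x)) \<longlonglongrightarrow> 0"
      using that by (intro Lim_null_comparison[of "\<lambda>n. norm (u n - x)" "\<lambda>n. 2 * h n"]) auto
    then show ?thesis using Lim_null tendsto_norm_zero_iff by blast
  qed
  have "(\<lambda>n. partial j (partial i f) (z n)) \<longlonglongrightarrow> partial j (partial i f) x"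
    using continuous_on_tendsto_compose[OF assms(5) lim[OF z]] by simp
  moreover have "(\<lambda>n. partial i (partial j f) (w n)) \<longlonglongrightarrow> partial i (partial j f) x"
    using continuous_on_tendsto_compose[OF assms(6) lim[OF w]] by simp
  ultimately show "partial i (partial j f) x = partial j (partial i f) x"
    unfolding eq by (rule LIMSEQ_unique[rotated])
qed

section \<open>Iterated partial derivatives\<close>

text \<open>
  Iterated derivatives are indexed by lists of coordinates, \<^term>\<open>fold partial is f\<close>, the head
  being differentiated first. A list can be extended at its end by one more derivative of the result,
  or at its front by one more derivative of \<open>f\<close>, which is the recursion of \<^const>\<open>Ck\<close>.
\<close>

lemma Ck_Suc_iff:
  "Ck (Suc k) f \<longleftrightarrow> continuous_on UNIV f \<and> (\<forall>i. partially_differentiable i f \<and> Ck k (partial i f))"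
  by (auto simp: partially_differentiable_def)

declare Ck.simps(2) [simp del]

lemma Ck_continuous: "Ck k f \<Longrightarrow> continuous_on UNIV f"
  by (cases k) (auto simp: Ck_Suc_iff)

lemma Ck_iterated_partial:
  "Ck (length is + m) f \<Longrightarrow> Ck m (fold partial is f)"
  by (induction "is" arbitrary: f) (auto simp: Ck_Suc_iff)

lemma Ck_mono: "Ck m f \<Longrightarrow> k \<le> m \<Longrightarrow> Ck k f"
proof (induction k arbitrary: f m)
  case 0
  then show ?case by (simp add: Ck_continuous)
next
  case (Suc k)
  then obtain m' where "m = Suc m'" by (cases m) auto
  with Suc show ?case by (auto simp: Ck_Suc_iff)
qed

lemma partially_differentiable_iterated_partial:
  assumes "Ck k f" "length is < k"
  shows "partially_differentiable i (fold partial is f)"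
proof -
  have "Ck (Suc 0) (fold partial is f)"
    by (rule Ck_iterated_partial, rule Ck_mono[OF assms(1)]) (use assms(2) in simp)
  then show ?thesis by (simp add: Ck_Suc_iff)
qed

lemma Ck_add: "Ck k f \<Longrightarrow> Ck k g \<Longrightarrow> Ck k (f + g)"
proof (induction k arbitrary: f g)
  case 0
  then show ?case by (auto simp: plus_fun_def intro!: continuous_intros)
next
  case (Suc k)
  then have pd: "partially_differentiable i f" "partially_differentiable i g" for i
    by (auto simp: Ck_Suc_iff)
  have "continuous_on UNIV (\<lambda>x. f x + g x)"
    using Suc.prems by (intro continuous_intros Ck_continuous)
  moreover have "Ck k (partial i (f + g))" for i
    using Suc unfolding partial_add(2)[OF pd] by (auto simp only: Ck_Suc_iff)
  ultimately show ?case
    unfolding Ck_Suc_iff using partial_add(1)[OF pd] by (simp only: plus_fun_def simp_thms)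
qed

lemma Ck_scaleR: "Ck k f \<Longrightarrow> Ck k (c *\<^sub>R f)"
proof (induction k arbitrary: f)
  case 0
  then show ?case by (auto simp: scaleR_fun_def intro!: continuous_intros)
next
  case (Suc k)
  then have pd: "partially_differentiable i f" for i
    by (auto simp: Ck_Suc_iff)
  have "continuous_on UNIV (\<lambda>x. c *\<^sub>R f x)"
    using Suc.prems by (intro continuous_intros Ck_continuous)
  moreover have "Ck k (partial i (c *\<^sub>R f))" for i
    using Suc unfolding partial_scaleR(2)[OF pd] by (auto simp only: Ck_Suc_iff)
  ultimately show ?case
    unfolding Ck_Suc_iff using partial_scaleR(1)[OF pd] by (simp only: scaleR_fun_def simp_thms)
qed

lemma iterated_partial_add:
  assumes "Ck k f" "Ck k g" "length is \<le> k"
  shows "fold partial is (f + g) = fold partial is f + fold partial is g"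
  using assms
proof (induction "is" arbitrary: k f g)
  case (Cons i "is")
  then obtain k' where k: "k = Suc k'" by (cases k) auto
  with Cons.prems have *: "partially_differentiable i f" "partially_differentiable i g"
    "Ck k' (partial i f)" "Ck k' (partial i g)" "length is \<le> k'"
    by (auto simp: Ck_Suc_iff)
  show ?case
    unfolding fold_Cons comp_apply partial_add(2)[OF *(1,2)] by (rule Cons.IH[OF *(3-5)])
qed simp

lemma iterated_partial_scaleR:
  assumes "Ck k f" "length is \<le> k"
  shows "fold partial is (c *\<^sub>R f) = c *\<^sub>R fold partial is f"
  using assms
proof (induction "is" arbitrary: k f)
  case (Cons i "is")
  then obtain k' where k: "k = Suc k'" by (cases k) auto
  with Cons.prems have *: "partially_differentiable i f" "Ck k' (partial i f)" "length is \<le> k'"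
    by (auto simp: Ck_Suc_iff)
  show ?case
    unfolding fold_Cons comp_apply partial_scaleR(2)[OF *(1)] by (rule Cons.IH[OF *(2,3)])
qed simp

text \<open>A derivative is moved past its predecessors one at a time; each swap is \<open>partial_commute\<close>.\<close>

lemma iterated_partial_move_front:
  assumes "Ck k f" "length (is @ i # js) \<le> k"
  shows "fold partial (is @ i # js) f = fold partial (i # is @ js) f"
  using assms
proof (induction "is" arbitrary: k f)
  case (Cons j "is")
  then obtain k' where k: "k = Suc (Suc k')" by (cases k; cases "k - 1") auto
  then have C: "Ck (Suc k') (partial j f)" "Ck (Suc k') (partial i f)" and C2: "Ck (Suc (Suc k')) f"
    using Cons.prems by (auto simp: Ck_Suc_iff)
  have "fold partial ((j # is) @ i # js) f = fold partial (i # is @ js) (partial j f)"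
    using Cons.IH[OF C(1)] Cons.prems k by simp
  also have "partial i (partial j f) = partial j (partial i f)"
    using C C2 by (intro partial_commute) (auto simp: Ck_Suc_iff dest: Ck_continuous)
  then have "fold partial (i # is @ js) (partial j f) = fold partial (i # (j # is) @ js) f" by simp
  finally show ?case .
qed simp

lemma iterated_partial_permute:
  assumes "Ck k f" "length is \<le> k" "mset is = mset js"
  shows "fold partial is f = fold partial js f"
  using assms
proof (induction "is" arbitrary: k f js)
  case (Cons i "is")
  then obtain k' where k: "k = Suc k'" by (cases k) auto
  from Cons.prems(3) have "i \<in> set js" by (metis list.set_intros(1) mset_eq_setD)
  then obtain as bs where js: "js = as @ i # bs" by (meson split_list)
  have "length js \<le> k" using Cons.prems by (metis mset_eq_length)
  then have "fold partial js f = fold partial (as @ bs) (partial i f)"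
    using iterated_partial_move_front[OF Cons.prems(1), of as i bs] js by simp
  also have "\<dots> = fold partial is (partial i f)"
    using Cons.prems k js by (intro Cons.IH[symmetric, of k']) (auto simp: Ck_Suc_iff)
  finally show ?case by simp
qed simp

text \<open>
  The list form of a multi-index, in the coordinate order that \<^const>\<open>mi_deriv\<close> uses. Every list of
  length at most \<open>k\<close> is a permutation of exactly one of these, so bounds on the derivatives \<open>D\<^sup>\<alpha>\<close>
  are bounds on all iterated derivatives.
\<close>

definition mi_list :: "('n::finite \<Rightarrow> nat) \<Rightarrow> 'n list" where
  "mi_list \<alpha> = concat (map (\<lambda>i. replicate (\<alpha> i) i) (SOME xs. distinct xs \<and> set xs = UNIV))"

lemma mi_deriv_eq_iterated_partial: "mi_deriv \<alpha> f = fold partial (mi_list \<alpha>) f"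
proof -
  have "fold (\<lambda>i. partial i ^^ \<alpha> i) xs f = fold partial (concat (map (\<lambda>i. replicate (\<alpha> i) i) xs)) f" for xs
    by (induction xs arbitrary: f) simp_all
  then show ?thesis by (simp add: mi_deriv_def mi_list_def)
qed

lemma count_mi_list: "count (mset (mi_list \<alpha>)) = (\<alpha> :: 'n::finite \<Rightarrow> nat)"
proof
  fix a :: 'n
  define xs where "xs = (SOME xs. distinct xs \<and> set xs = (UNIV::'n set))"
  have xs: "distinct xs \<and> set xs = UNIV"
    unfolding xs_def by (rule someI_ex) (use finite_distinct_list[OF finite] in blast)
  have "count (mset (concat (map (\<lambda>i. replicate (\<alpha> i) i) ys))) a = (if a \<in> set ys then \<alpha> a else 0)"
    if "distinct ys" for ys
    using that by (induction ys) auto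
  then show "count (mset (mi_list \<alpha>)) a = \<alpha> a"
    using xs by (simp add: mi_list_def xs_def[symmetric])
qed

lemma length_mi_list: "length (mi_list \<alpha>) = mi_order \<alpha>"
proof -
  have "size (mset (mi_list \<alpha>)) = (\<Sum>i\<in>UNIV. count (mset (mi_list \<alpha>)) i)"
    unfolding size_multiset_overloaded_eq
    by (intro sum.mono_neutral_left) auto
  then show ?thesis by (simp add: count_mi_list mi_order_def)
qed

lemma mset_mi_list: "mset (mi_list (count (mset is))) = mset is"
  by (rule multiset_eqI) (simp add: count_mi_list)

lemma iterated_partial_eq_mi_deriv:
  assumes "Ck k f" "length is \<le> k"
  shows "fold partial is f = mi_deriv (count (mset is)) f" "mi_order (count (mset is)) = length is"
  using iterated_partial_permute[OF assms mset_mi_list[symmetric]]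
  by (simp_all add: mi_deriv_eq_iterated_partial flip: length_mi_list size_mset)
    (simp add: mset_mi_list)

section \<open>Duals of spaces with a homogeneous norm\<close>

lemma dual_spaceI:
  assumes "\<And>f g. f \<in> V \<Longrightarrow> g \<in> V \<Longrightarrow> \<phi> (f + g) = \<phi> f + \<phi> g"
    and "\<And>c f. f \<in> V \<Longrightarrow> \<phi> (c *\<^sub>R f) = c * \<phi> f"
    and "\<And>f. f \<in> V \<Longrightarrow> \<bar>\<phi> f\<bar> \<le> B * N f"
    and "\<And>f. f \<notin> V \<Longrightarrow> \<phi> f = 0"
  shows "\<phi> \<in> dual_space V N"
  unfolding dual_space_def bounded_linear_between_def
  using assms by (auto intro: exI[of _ B])

lemma dual_spaceD:
  assumes "\<phi> \<in> dual_space V N"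
  shows "f \<in> V \<Longrightarrow> g \<in> V \<Longrightarrow> \<phi> (f + g) = \<phi> f + \<phi> g"
    and "f \<in> V \<Longrightarrow> \<phi> (c *\<^sub>R f) = c * \<phi> f"
    and "f \<notin> V \<Longrightarrow> \<phi> f = 0"
  using assms unfolding dual_space_def bounded_linear_between_def by auto

lemma dual_space_diff:
  assumes "\<phi> \<in> dual_space V N" "subspace V" "f \<in> V" "g \<in> V"
  shows "\<phi> (f - g) = \<phi> f - \<phi> g"
  using dual_spaceD(1)[OF assms(1), of f "(-1) *\<^sub>R g"] dual_spaceD(2)[OF assms(1,4), of "-1"]
    subspace_scale[OF assms(2,4), of "-1"] assms(3) by simp

lemma dual_space_sum:
  assumes "\<phi> \<in> dual_space V N" "subspace V" "\<And>i. i \<in> I \<Longrightarrow> v i \<in> V"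
  shows "\<phi> (\<Sum>i\<in>I. c i *\<^sub>R v i) = (\<Sum>i\<in>I. c i * \<phi> (v i))"
  using assms(3)
proof (induction I rule: infinite_finite_induct)
  case (insert i I)
  then have "(\<Sum>i\<in>I. c i *\<^sub>R v i) \<in> V" "c i *\<^sub>R v i \<in> V"
    using assms(2) by (auto intro: subspace_sum subspace_scale)
  then show ?case
    using insert by (simp add: dual_spaceD(1,2)[OF assms(1)])
qed (use dual_spaceD(2)[OF assms(1) subspace_0[OF assms(2)], of 0] in auto)

lemma dual_space_bound:
  assumes "\<phi> \<in> dual_space V N" "\<And>f. f \<in> V \<Longrightarrow> 0 \<le> N f"
  obtains B where "0 \<le> B" "\<And>f. f \<in> V \<Longrightarrow> \<bar>\<phi> f\<bar> \<le> B * N f"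
proof -
  obtain B where B: "\<And>f. f \<in> V \<Longrightarrow> \<bar>\<phi> f\<bar> \<le> B * N f"
    using assms(1) unfolding dual_space_def bounded_linear_between_def by blast
  have "\<bar>\<phi> f\<bar> \<le> \<bar>B\<bar> * N f" if "f \<in> V" for f
    using B[OF that] mult_right_mono[OF abs_ge_self[of B] assms(2)[OF that]] by linarith
  then show thesis using that[of "\<bar>B\<bar>"] by simp
qed

lemma closed_subspace_limit:
  assumes "closed_subspace_of U V N" "v \<in> V" "(\<lambda>j. N (u j - v)) \<longlonglongrightarrow> 0" "\<And>j::nat. u j \<in> U"
  shows "v \<in> U"
proof -
  have "(\<forall>j. u j \<in> U) \<and> v \<in> V \<and> (\<lambda>j. N (u j - v)) \<longlonglongrightarrow> 0 \<longrightarrow> v \<in> U"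
    using assms(1) unfolding closed_subspace_of_def by iprover
  then show ?thesis using assms(2-4) by iprover
qed

text \<open>
  Homogeneity is what lets the supremum over the unit ball control a functional on the whole space.
\<close>

locale homogeneous_norm =
  fixes V :: "'a::real_vector set" and N :: "'a \<Rightarrow> real"
  assumes subspace_V: "subspace V"
    and N_nonneg: "f \<in> V \<Longrightarrow> 0 \<le> N f"
    and N_scaleR: "f \<in> V \<Longrightarrow> N (c *\<^sub>R f) = \<bar>c\<bar> * N f"
begin

abbreviation "dual \<equiv> dual_space V N"
abbreviation "dnorm \<equiv> dual_norm V N"

lemma dual_norm_bound:
  assumes "\<phi> \<in> dual" "f \<in> V"
  shows "\<bar>\<phi> f\<bar> \<le> dnorm \<phi> * N f"
proof -
  obtain B where B: "0 \<le> B" "\<And>f. f \<in> V \<Longrightarrow> \<bar>\<phi> f\<bar> \<le> B * N f"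
    using dual_space_bound[OF assms(1) N_nonneg] by blast
  have bdd: "bdd_above {\<bar>\<phi> f\<bar> | f. f \<in> V \<and> N f \<le> 1}"
  proof (rule bdd_aboveI[of _ B], clarify)
    fix f assume "f \<in> V" "N f \<le> 1"
    then show "\<bar>\<phi> f\<bar> \<le> B"
      using B(2)[of f] mult_left_mono[OF \<open>N f \<le> 1\<close> B(1)] by linarith
  qed
  show ?thesis
  proof (cases "N f = 0")
    case True
    then show ?thesis using B(2)[OF assms(2)] by simp
  next
    case False
    then have pos: "N f > 0" using N_nonneg[OF assms(2)] by simp
    define g where "g = inverse (N f) *\<^sub>R f"
    have g: "g \<in> V" "N g \<le> 1"
      using assms(2) pos by (auto simp: g_def N_scaleR subspace_scale[OF subspace_V])
    then have "\<bar>\<phi> g\<bar> \<le> dnorm \<phi>"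
      unfolding dual_norm_def by (intro cSup_upper[OF _ bdd]) blast
    moreover have "\<bar>\<phi> g\<bar> = \<bar>\<phi> f\<bar> / N f"
      using pos by (simp add: g_def dual_spaceD(2)[OF assms] abs_mult divide_inverse)
    ultimately show ?thesis using pos by (simp add: divide_le_eq)
  qed
qed

lemma dual_norm_le:
  assumes "0 \<le> C" "\<And>f. f \<in> V \<Longrightarrow> \<bar>\<phi> f\<bar> \<le> C * N f"
  shows "dnorm \<phi> \<le> C"
  unfolding dual_norm_def
proof (rule cSup_least)
  have "0 \<in> V" "N 0 \<le> 1"
    using subspace_0[OF subspace_V] N_scaleR[of 0 0] by auto
  then show "{\<bar>\<phi> f\<bar> | f. f \<in> V \<and> N f \<le> 1} \<noteq> {}" by blast
next
  fix r assume "r \<in> {\<bar>\<phi> f\<bar> | f. f \<in> V \<and> N f \<le> 1}"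
  then obtain f where "r = \<bar>\<phi> f\<bar>" "f \<in> V" "N f \<le> 1" by blast
  then show "r \<le> C"
    using assms(2)[of f] mult_left_mono[OF \<open>N f \<le> 1\<close> assms(1)] by simp
qed

lemma dual_norm_nonneg:
  assumes "\<phi> \<in> dual"
  shows "0 \<le> dnorm \<phi>"
proof -
  obtain B where "\<And>f. f \<in> V \<Longrightarrow> \<bar>\<phi> f\<bar> \<le> B * N f" "0 \<le> B"
    using dual_space_bound[OF assms N_nonneg] by blast
  then have "bdd_above {\<bar>\<phi> f\<bar> | f. f \<in> V \<and> N f \<le> 1}"
    by (intro bdd_aboveI[of _ B]) (clarify, metis mult_left_mono mult.right_neutral order_trans)
  moreover have "0 \<in> V" "N 0 \<le> 1"
    using subspace_0[OF subspace_V] N_scaleR[of 0 0] by auto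
  ultimately have "\<bar>\<phi> 0\<bar> \<le> dnorm \<phi>"
    unfolding dual_norm_def by (intro cSup_upper) blast+
  then show ?thesis by linarith
qed

lemma subspace_dual: "subspace dual"
proof (rule subspaceI)
  show "0 \<in> dual" by (rule dual_spaceI[where B = 0]) auto
next
  fix \<phi> \<psi> assume *: "\<phi> \<in> dual" "\<psi> \<in> dual"
  have "\<bar>(\<phi> + \<psi>) f\<bar> \<le> (dnorm \<phi> + dnorm \<psi>) * N f" if "f \<in> V" for f
    using dual_norm_bound[OF *(1) that] dual_norm_bound[OF *(2) that]
    by (simp add: distrib_right)
  then show "\<phi> + \<psi> \<in> dual"
    by (intro dual_spaceI[where B = "dnorm \<phi> + dnorm \<psi>"])
      (simp_all add: dual_spaceD[OF *(1)] dual_spaceD[OF *(2)] algebra_simps)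
next
  fix c \<phi> assume *: "\<phi> \<in> dual"
  have "\<bar>(c *\<^sub>R \<phi>) f\<bar> \<le> (\<bar>c\<bar> * dnorm \<phi>) * N f" if "f \<in> V" for f
    using mult_left_mono[OF dual_norm_bound[OF * that], of "\<bar>c\<bar>"]
    by (simp add: scaleR_fun_def abs_mult mult.assoc)
  then show "c *\<^sub>R \<phi> \<in> dual"
    by (intro dual_spaceI[where B = "\<bar>c\<bar> * dnorm \<phi>"])
      (simp_all add: scaleR_fun_def dual_spaceD[OF *] algebra_simps)
qed

lemma dual_norm_convergence_pointwise:
  assumes "\<And>j. u j \<in> dual" "v \<in> dual" "(\<lambda>j. dnorm (u j - v)) \<longlonglongrightarrow> 0" "f \<in> V"
  shows "(\<lambda>j. u j f) \<longlonglongrightarrow> v f"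
proof -
  have "(\<lambda>j. dnorm (u j - v) * N f) \<longlonglongrightarrow> 0 * N f"
    by (intro tendsto_intros assms(3))
  moreover have "norm (u j f - v f) \<le> dnorm (u j - v) * N f" for j
    using dual_norm_bound[OF subspace_diff[OF subspace_dual assms(1,2)] assms(4), of j] by simp
  ultimately have "(\<lambda>j. u j f - v f) \<longlonglongrightarrow> 0"
    by (intro Lim_null_comparison[of "\<lambda>j. u j f - v f"]) auto
  then show ?thesis using Lim_null by blast
qed

definition closed_span :: "('a \<Rightarrow> real) set \<Rightarrow> ('a \<Rightarrow> real) set" where
  "closed_span A = \<Inter>{U. closed_subspace_of U dual dnorm \<and> A \<subseteq> U}"

lemma closed_span_minimal: "closed_subspace_of U dual dnorm \<Longrightarrow> A \<subseteq> U \<Longrightarrow> closed_span A \<subseteq> U"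
  unfolding closed_span_def by blast

lemma closed_subspace_dual: "closed_subspace_of dual dual dnorm"
  unfolding closed_subspace_of_def using subspace_dual by blast

lemma closed_subspace_closed_span:
  assumes "A \<subseteq> dual"
  shows "closed_subspace_of (closed_span A) dual dnorm"
proof -
  have sub: "closed_span A \<subseteq> dual" "subspace (closed_span A)"
    using closed_span_minimal[OF closed_subspace_dual assms] subspace_Inter[of "{U. closed_subspace_of U dual dnorm \<and> A \<subseteq> U}"]
    by (auto simp: closed_subspace_of_def closed_span_def)
  have "v \<in> U" if "\<forall>j::nat. u j \<in> closed_span A" "v \<in> dual" "(\<lambda>j. dnorm (u j - v)) \<longlonglongrightarrow> 0"
    and U: "closed_subspace_of U dual dnorm" "A \<subseteq> U" for u v U
  proof -
    have "\<forall>j. u j \<in> U" using that(1) closed_span_minimal[OF U] by blast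
    then show ?thesis using U(1) that(2,3) unfolding closed_subspace_of_def by blast
  qed
  then have limits: "v \<in> closed_span A" if "\<forall>j::nat. u j \<in> closed_span A" "v \<in> dual"
    "(\<lambda>j. dnorm (u j - v)) \<longlonglongrightarrow> 0" for u v
    using that by (subst closed_span_def) blast
  from sub(1) sub(2) limits show ?thesis
    unfolding closed_subspace_of_def by blast
qed

lemma closed_span_mono: "A \<subseteq> B \<Longrightarrow> closed_span A \<subseteq> closed_span B"
  unfolding closed_span_def by blast

text \<open>
  The adjoint \<open>\<phi> \<mapsto> \<phi> \<circ> R\<close> of an operator \<open>R\<close> on the underlying space is linear and continuous on the
  dual. Hence the functionals that it sends into a closed subspace form a closed subspace, and so do
  the functionals that it fixes: a condition on generators extends to their closed span.
\<close>

lemma adjoint_on_add: "adjoint_on V R (\<phi> + \<psi>) = adjoint_on V R \<phi> + adjoint_on V R \<psi>"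
  by (auto simp: adjoint_on_def)

lemma adjoint_on_scaleR: "adjoint_on V R (c *\<^sub>R \<phi>) = c *\<^sub>R adjoint_on V R \<phi>"
  by (auto simp: adjoint_on_def scaleR_fun_def)

lemma adjoint_on_diff: "adjoint_on V R (\<phi> - \<psi>) = adjoint_on V R \<phi> - adjoint_on V R \<psi>"
  by (auto simp: adjoint_on_def)

lemma adjoint_on_bounded:
  assumes R: "bounded_linear_between V N V N R"
  obtains C where "0 \<le> C" "\<And>\<phi>. \<phi> \<in> dual \<Longrightarrow> adjoint_on V R \<phi> \<in> dual"
    "\<And>\<phi>. \<phi> \<in> dual \<Longrightarrow> dnorm (adjoint_on V R \<phi>) \<le> C * dnorm \<phi>"
proof -
  obtain B where B: "\<And>f. f \<in> V \<Longrightarrow> N (R f) \<le> B * N f"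
    using R unfolding bounded_linear_between_def by blast
  have RV: "R f \<in> V" if "f \<in> V" for f
    using R that unfolding bounded_linear_between_def by blast
  have bound: "\<bar>adjoint_on V R \<phi> f\<bar> \<le> (\<bar>B\<bar> * dnorm \<phi>) * N f" if "\<phi> \<in> dual" "f \<in> V" for \<phi> f
  proof -
    have "\<bar>adjoint_on V R \<phi> f\<bar> \<le> dnorm \<phi> * N (R f)"
      using dual_norm_bound[OF that(1) RV] that(2) by (simp add: adjoint_on_def)
    also have "N (R f) \<le> \<bar>B\<bar> * N f"
      using B[OF that(2)] mult_right_mono[OF abs_ge_self[of B] N_nonneg[OF that(2)]] by linarith
    then have "dnorm \<phi> * N (R f) \<le> dnorm \<phi> * (\<bar>B\<bar> * N f)"
      by (rule mult_left_mono) (rule dual_norm_nonneg[OF that(1)])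
    finally show ?thesis by (simp add: mult_ac)
  qed
  have "adjoint_on V R \<phi> \<in> dual" if "\<phi> \<in> dual" for \<phi>
  proof (rule dual_spaceI[OF _ _ bound[OF that]])
    show "adjoint_on V R \<phi> (f + g) = adjoint_on V R \<phi> f + adjoint_on V R \<phi> g"
      if fg: "f \<in> V" "g \<in> V" for f g
    proof -
      have "R (f + g) = R f + R g" "f + g \<in> V"
        using R fg subspace_add[OF subspace_V] unfolding bounded_linear_between_def by auto
      then show ?thesis
        using fg by (simp add: adjoint_on_def dual_spaceD(1)[OF \<open>\<phi> \<in> dual\<close>] RV)
    qed
    show "adjoint_on V R \<phi> (c *\<^sub>R f) = c * adjoint_on V R \<phi> f" if f: "f \<in> V" for c f
    proof -
      have "R (c *\<^sub>R f) = c *\<^sub>R R f" "c *\<^sub>R f \<in> V"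
        using R f subspace_scale[OF subspace_V] unfolding bounded_linear_between_def by auto
      then show ?thesis
        using f by (simp add: adjoint_on_def dual_spaceD(2)[OF \<open>\<phi> \<in> dual\<close>] RV)
    qed
  qed (simp_all add: adjoint_on_def)
  then show thesis
    using that[of "\<bar>B\<bar>"] dual_norm_le[OF _ bound] dual_norm_nonneg by simp
qed

lemma closed_subspace_adjoint_preimage:
  assumes R: "bounded_linear_between V N V N R" and U: "closed_subspace_of U dual dnorm"
  shows "closed_subspace_of {\<phi> \<in> dual. adjoint_on V R \<phi> \<in> U} dual dnorm"
proof -
  obtain C where C: "0 \<le> C" "\<And>\<phi>. \<phi> \<in> dual \<Longrightarrow> adjoint_on V R \<phi> \<in> dual"
    "\<And>\<phi>. \<phi> \<in> dual \<Longrightarrow> dnorm (adjoint_on V R \<phi>) \<le> C * dnorm \<phi>"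
    using adjoint_on_bounded[OF R] by metis
  have sU: "subspace U" using U by (simp add: closed_subspace_of_def)
  have "subspace {\<phi> \<in> dual. adjoint_on V R \<phi> \<in> U}"
  proof (rule subspaceI)
    have "adjoint_on V R 0 = 0" by (auto simp: adjoint_on_def)
    then show "0 \<in> {\<phi> \<in> dual. adjoint_on V R \<phi> \<in> U}"
      using subspace_0[OF sU] subspace_0[OF subspace_dual] by simp
  qed (auto simp: adjoint_on_add adjoint_on_scaleR
      intro: subspace_add[OF sU] subspace_scale[OF sU] subspace_add[OF subspace_dual] subspace_scale[OF subspace_dual])
  moreover have "adjoint_on V R v \<in> U"
    if u: "\<forall>j::nat. u j \<in> {\<phi> \<in> dual. adjoint_on V R \<phi> \<in> U}" and v: "v \<in> dual"
      and lim: "(\<lambda>j. dnorm (u j - v)) \<longlonglongrightarrow> 0" for u v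
  proof -
    have d: "u j - v \<in> dual" for j
      using u v subspace_diff[OF subspace_dual] by blast
    have "(\<lambda>j. C * dnorm (u j - v)) \<longlonglongrightarrow> C * 0"
      by (intro tendsto_intros lim)
    moreover have "norm (dnorm (adjoint_on V R (u j) - adjoint_on V R v)) \<le> C * dnorm (u j - v)" for j
      using C(3)[OF d[of j]] dual_norm_nonneg[OF C(2)[OF d[of j]]] by (simp add: adjoint_on_diff)
    ultimately have "(\<lambda>j. dnorm (adjoint_on V R (u j) - adjoint_on V R v)) \<longlonglongrightarrow> 0"
      by (intro Lim_null_comparison[of "\<lambda>j. dnorm (adjoint_on V R (u j) - adjoint_on V R v)"]) auto
    then show ?thesis
      using u by (intro closed_subspace_limit[OF U C(2)[OF v], of "\<lambda>j. adjoint_on V R (u j)"]) auto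
  qed
  ultimately show ?thesis unfolding closed_subspace_of_def by blast
qed

text \<open>Norm limits are pointwise limits, and \<open>adjoint_on V R u = u\<close> is a pointwise condition on \<open>u\<close>.\<close>

lemma closed_subspace_adjoint_fixed:
  assumes R: "bounded_linear_between V N V N R"
  shows "closed_subspace_of {\<phi> \<in> dual. adjoint_on V R \<phi> = \<phi>} dual dnorm"
proof -
  have RV: "R f \<in> V" if "f \<in> V" for f
    using R that unfolding bounded_linear_between_def by blast
  have "subspace {\<phi> \<in> dual. adjoint_on V R \<phi> = \<phi>}"
  proof (rule subspaceI)
    show "0 \<in> {\<phi> \<in> dual. adjoint_on V R \<phi> = \<phi>}"
      using subspace_0[OF subspace_dual] by (auto simp: adjoint_on_def)
  qed (auto simp: adjoint_on_add adjoint_on_scaleR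
      intro: subspace_add[OF subspace_dual] subspace_scale[OF subspace_dual])
  moreover have "adjoint_on V R v = v"
    if u: "\<forall>j::nat. u j \<in> {\<phi> \<in> dual. adjoint_on V R \<phi> = \<phi>}" and v: "v \<in> dual"
      and lim: "(\<lambda>j. dnorm (u j - v)) \<longlonglongrightarrow> 0" for u v
  proof
    fix f
    show "adjoint_on V R v f = v f"
    proof (cases "f \<in> V")
      case True
      have ud: "u j \<in> dual" and fixd: "adjoint_on V R (u j) = u j" for j
        using u by auto
      have "u j (R f) = u j f" for j
        using fun_cong[OF fixd[of j], of f] True by (simp add: adjoint_on_def)
      then have "v (R f) = v f"
        using LIMSEQ_unique[OF dual_norm_convergence_pointwise[OF ud v lim RV[OF True]]]
          dual_norm_convergence_pointwise[OF ud v lim True] by simp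
      then show ?thesis using True by (simp add: adjoint_on_def)
    qed (simp add: adjoint_on_def dual_spaceD(3)[OF v])
  qed
  ultimately show ?thesis unfolding closed_subspace_of_def by blast
qed

lemma adjoint_projection:
  assumes R: "bounded_linear_between V N V N R"
    and A: "A \<subseteq> dual" "B \<subseteq> A"
    and into: "\<And>\<phi>. \<phi> \<in> A \<Longrightarrow> adjoint_on V R \<phi> \<in> closed_span B"
    and fixes_B: "\<And>\<phi>. \<phi> \<in> B \<Longrightarrow> adjoint_on V R \<phi> = \<phi>"
  shows "bounded_linear_projection_onto (closed_span A) (closed_span B) dnorm (adjoint_on V R)"
proof -
  have B: "B \<subseteq> dual" using A by blast
  have "closed_span A \<subseteq> {\<phi> \<in> dual. adjoint_on V R \<phi> \<in> closed_span B}"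
    using closed_subspace_adjoint_preimage[OF R closed_subspace_closed_span[OF B]] A into
    by (intro closed_span_minimal) auto
  then have span_into: "\<phi> \<in> dual" "adjoint_on V R \<phi> \<in> closed_span B" if "\<phi> \<in> closed_span A" for \<phi>
    using that by blast+
  have "closed_span B \<subseteq> {\<phi> \<in> dual. adjoint_on V R \<phi> = \<phi>}"
    using closed_subspace_adjoint_fixed[OF R] B fixes_B by (intro closed_span_minimal) auto
  then have span_fixed: "adjoint_on V R \<phi> = \<phi>" if "\<phi> \<in> closed_span B" for \<phi>
    using that by blast
  obtain C where "\<And>\<phi>. \<phi> \<in> dual \<Longrightarrow> dnorm (adjoint_on V R \<phi>) \<le> C * dnorm \<phi>"
    using adjoint_on_bounded[OF R] by metis
  then have "bounded_linear_between (closed_span A) dnorm (closed_span B) dnorm (adjoint_on V R)"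
    unfolding bounded_linear_between_def
    using span_into by (auto simp: adjoint_on_add adjoint_on_scaleR)
  moreover have "adjoint_on V R ` closed_span A = closed_span B"
  proof
    show "closed_span B \<subseteq> adjoint_on V R ` closed_span A"
      using closed_span_mono[OF A(2)] span_fixed by force
  qed (use span_into in auto)
  ultimately show ?thesis
    unfolding bounded_linear_projection_onto_def using span_into span_fixed by auto
qed

end

section \<open>The space of functions with uniformly continuous top-order derivatives\<close>

lemma modulus_pos: "modulus_of_continuity \<omega> \<Longrightarrow> 0 < t \<Longrightarrow> 0 < \<omega> t"
  by (simp add: modulus_of_continuity_def)

lemma modulus_mono: "modulus_of_continuity \<omega> \<Longrightarrow> 0 < s \<Longrightarrow> s \<le> t \<Longrightarrow> \<omega> s \<le> \<omega> t"
  by (auto simp: modulus_of_continuity_def mono_on_def)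

text \<open>
  The norm bound \<open>Cbkw_norm k \<omega> f \<le> B\<close>, written out for iterated derivatives in every order of
  differentiation instead of multi-indices.
\<close>

definition derivatives_bounded :: "nat \<Rightarrow> (real \<Rightarrow> real) \<Rightarrow> real \<Rightarrow> (real^'n \<Rightarrow> real) \<Rightarrow> bool" where
  "derivatives_bounded k \<omega> B f \<longleftrightarrow>
     (\<forall>is x. length is \<le> k \<longrightarrow> \<bar>fold partial is f x\<bar> \<le> B) \<and>
     (\<forall>is x y. length is = k \<longrightarrow> x \<noteq> y \<longrightarrow>
        \<bar>fold partial is f x - fold partial is f y\<bar> \<le> B * \<omega> (norm (x - y)))"

lemma Cbkw_enorm_le_iff:
  fixes f :: "real^'n \<Rightarrow> real"
  assumes "modulus_of_continuity \<omega>" "Ck k f"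
  shows "Cbkw_enorm k \<omega> f \<le> ereal B \<longleftrightarrow> derivatives_bounded k \<omega> B f"
proof -
  have "Cbkw_enorm k \<omega> f \<le> ereal B \<longleftrightarrow>
      (\<forall>\<alpha> x. mi_order \<alpha> \<le> k \<longrightarrow> \<bar>mi_deriv \<alpha> f x\<bar> \<le> B) \<and>
      (\<forall>\<alpha> x y. mi_order \<alpha> = k \<longrightarrow> x \<noteq> y \<longrightarrow> \<bar>mi_deriv \<alpha> f x - mi_deriv \<alpha> f y\<bar> \<le> B * \<omega> (norm (x - y)))"
    using modulus_pos[OF assms(1)]
    by (auto simp: Cbkw_enorm_def Cbk_enorm_def Cbkw_eseminorm_def SUP_le_iff pos_divide_le_eq)
  also have "\<dots> \<longleftrightarrow> derivatives_bounded k \<omega> B f"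
  proof
    assume *: "(\<forall>\<alpha> x. mi_order \<alpha> \<le> k \<longrightarrow> \<bar>mi_deriv \<alpha> f x\<bar> \<le> B) \<and>
      (\<forall>\<alpha> x y. mi_order \<alpha> = k \<longrightarrow> x \<noteq> y \<longrightarrow> \<bar>mi_deriv \<alpha> f x - mi_deriv \<alpha> f y\<bar> \<le> B * \<omega> (norm (x - y)))"
    show "derivatives_bounded k \<omega> B f"
      unfolding derivatives_bounded_def
      using * iterated_partial_eq_mi_deriv[OF assms(2)] by simp
  next
    assume *: "derivatives_bounded k \<omega> B f"
    show "(\<forall>\<alpha> x. mi_order \<alpha> \<le> k \<longrightarrow> \<bar>mi_deriv \<alpha> f x\<bar> \<le> B) \<and>
      (\<forall>\<alpha> x y. mi_order \<alpha> = k \<longrightarrow> x \<noteq> y \<longrightarrow> \<bar>mi_deriv \<alpha> f x - mi_deriv \<alpha> f y\<bar> \<le> B * \<omega> (norm (x - y)))"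
      using * unfolding derivatives_bounded_def by (simp add: mi_deriv_eq_iterated_partial length_mi_list)
  qed
  finally show ?thesis .
qed

lemma Cbkw_enorm_nonneg: "0 \<le> Cbkw_enorm k \<omega> (f :: real^'n \<Rightarrow> real)"
proof -
  have "mi_order (\<lambda>_::'n. 0) \<le> k" by (simp add: mi_order_def)
  then have "0 \<le> Cbk_enorm k f"
    unfolding Cbk_enorm_def by (intro SUP_upper2[of "\<lambda>_. 0"] SUP_upper2[of 0]) auto
  then show ?thesis by (simp add: Cbkw_enorm_def le_max_iff_disj)
qed

lemma Cbkw_norm_nonneg: "0 \<le> Cbkw_norm k \<omega> (f :: real^'n \<Rightarrow> real)"
  unfolding Cbkw_norm_def by (rule real_of_ereal_pos[OF Cbkw_enorm_nonneg])

lemma CbkwD: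
  assumes "modulus_of_continuity \<omega>" "f \<in> Cbkw k \<omega>"
  shows "Ck k f" "derivatives_bounded k \<omega> (Cbkw_norm k \<omega> f) f"
proof -
  show C: "Ck k f" using assms(2) by (simp add: Cbkw_def)
  have "Cbkw_enorm k \<omega> f = ereal (Cbkw_norm k \<omega> f)"
    using assms(2) Cbkw_enorm_nonneg[of k \<omega> f]
    by (cases "Cbkw_enorm k \<omega> f") (auto simp: Cbkw_def Cbkw_norm_def)
  then show "derivatives_bounded k \<omega> (Cbkw_norm k \<omega> f) f"
    using Cbkw_enorm_le_iff[OF assms(1) C, of "Cbkw_norm k \<omega> f"] by (simp only: order_refl simp_thms)
qed

lemma CbkwI:
  assumes "modulus_of_continuity \<omega>" "Ck k f" "derivatives_bounded k \<omega> B f"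
  shows "f \<in> Cbkw k \<omega>" "Cbkw_norm k \<omega> f \<le> B"
proof -
  have le: "Cbkw_enorm k \<omega> f \<le> ereal B"
    using Cbkw_enorm_le_iff assms by blast
  then show "f \<in> Cbkw k \<omega>"
    using assms(2) by (auto simp: Cbkw_def)
  show "Cbkw_norm k \<omega> f \<le> B"
    unfolding Cbkw_norm_def using real_of_ereal_positive_mono[OF Cbkw_enorm_nonneg le] by simp
qed

lemma derivatives_bounded_add:
  assumes "Ck k f" "Ck k g" "derivatives_bounded k \<omega> B f" "derivatives_bounded k \<omega> C g"
  shows "derivatives_bounded k \<omega> (B + C) (f + g)"
  unfolding derivatives_bounded_def
proof (intro conjI allI impI)
  fix "is" :: "'a list" and x assume "length is \<le> k"
  then have "fold partial is (f + g) x = fold partial is f x + fold partial is g x"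
    "\<bar>fold partial is f x\<bar> \<le> B" "\<bar>fold partial is g x\<bar> \<le> C"
    using assms(3,4) iterated_partial_add[OF assms(1,2)] by (simp_all add: derivatives_bounded_def)
  then show "\<bar>fold partial is (f + g) x\<bar> \<le> B + C" by linarith
next
  fix "is" :: "'a list" and x y :: "real^'a" assume len: "length is = k" and "x \<noteq> y"
  then have "\<bar>fold partial is f x - fold partial is f y\<bar> \<le> B * \<omega> (norm (x - y))"
    "\<bar>fold partial is g x - fold partial is g y\<bar> \<le> C * \<omega> (norm (x - y))"
    using assms(3,4) by (simp_all add: derivatives_bounded_def)
  moreover have "fold partial is (f + g) z = fold partial is f z + fold partial is g z" for z
    using iterated_partial_add[OF assms(1,2), of "is"] len by simp
  ultimately show "\<bar>fold partial is (f + g) x - fold partial is (f + g) y\<bar> \<le> (B + C) * \<omega> (norm (x - y))"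
    by (simp add: distrib_right)
qed

lemma derivatives_bounded_scaleR:
  assumes "Ck k f" "derivatives_bounded k \<omega> B f"
  shows "derivatives_bounded k \<omega> (\<bar>c\<bar> * B) (c *\<^sub>R f)"
proof -
  have *: "fold partial is (c *\<^sub>R f) z = c * fold partial is f z" if "length is \<le> k" for "is" z
    using iterated_partial_scaleR[OF assms(1) that] by (simp add: scaleR_fun_def)
  show ?thesis
    using assms(2) unfolding derivatives_bounded_def
    by (auto simp: * abs_mult mult.assoc mult_left_mono simp flip: right_diff_distrib)
qed

lemma Cbkw_scaleR:
  assumes "modulus_of_continuity \<omega>" "f \<in> Cbkw k \<omega>"
  shows "c *\<^sub>R f \<in> Cbkw k \<omega>" "Cbkw_norm k \<omega> (c *\<^sub>R f) \<le> \<bar>c\<bar> * Cbkw_norm k \<omega> f"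
  using CbkwI[OF assms(1) Ck_scaleR derivatives_bounded_scaleR] CbkwD[OF assms] by blast+

lemma homogeneous_norm_Cbkw:
  assumes "modulus_of_continuity \<omega>"
  shows "homogeneous_norm (Cbkw k \<omega> :: (real^'n \<Rightarrow> real) set) (Cbkw_norm k \<omega>)"
proof
  show "subspace (Cbkw k \<omega> :: (real^'n \<Rightarrow> real) set)"
  proof (rule subspaceI)
    have partial_zero: "partial i (\<lambda>_. 0) = (\<lambda>_. 0)" for i :: 'n
      by (rule ext) (simp add: partial_def DERIV_imp_deriv)
    have zero: "Ck m (\<lambda>_::real^'n. 0)" for m
      by (induction m) (simp_all add: Ck_Suc_iff partially_differentiable_def partial_zero)
    have "fold partial is (\<lambda>_::real^'n. 0) = (\<lambda>_. 0)" for "is"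
      by (induction "is") (simp_all add: partial_zero)
    then have "derivatives_bounded k \<omega> 0 (\<lambda>_::real^'n. 0)"
      by (simp add: derivatives_bounded_def)
    then show "0 \<in> (Cbkw k \<omega> :: (real^'n \<Rightarrow> real) set)"
      using CbkwI[OF assms zero] by (simp add: zero_fun_def)
  next
    fix f g :: "real^'n \<Rightarrow> real" assume "f \<in> Cbkw k \<omega>" "g \<in> Cbkw k \<omega>"
    then show "f + g \<in> Cbkw k \<omega>"
      using CbkwI(1)[OF assms Ck_add derivatives_bounded_add] CbkwD[OF assms] by blast
  qed (rule Cbkw_scaleR(1)[OF assms])
next
  fix f :: "real^'n \<Rightarrow> real" and c :: real
  assume f: "f \<in> Cbkw k \<omega>"
  show "Cbkw_norm k \<omega> (c *\<^sub>R f) = \<bar>c\<bar> * Cbkw_norm k \<omega> f"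
  proof (cases "c = 0")
    case True
    then show ?thesis
      using Cbkw_scaleR(2)[OF assms f, of c] Cbkw_norm_nonneg[of k \<omega> "c *\<^sub>R f"] by simp
  next
    case False
    have "Cbkw_norm k \<omega> (inverse c *\<^sub>R (c *\<^sub>R f)) \<le> \<bar>inverse c\<bar> * Cbkw_norm k \<omega> (c *\<^sub>R f)"
      by (rule Cbkw_scaleR(2)[OF assms Cbkw_scaleR(1)[OF assms f]])
    then have "\<bar>c\<bar> * Cbkw_norm k \<omega> f \<le> Cbkw_norm k \<omega> (c *\<^sub>R f)"
      using False by (simp add: field_simps)
    then show ?thesis using Cbkw_scaleR(2)[OF assms f, of c] by simp
  qed
qed (rule Cbkw_norm_nonneg)

text \<open>
  A common modulus of continuity, in dimension \<open>n\<close>, for all derivatives of order at most \<open>k\<close> of a function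
  of norm at most 1: those of order \<open>k\<close> have modulus \<open>\<omega>\<close> by the definition of the norm, and the lower
  ones are Lipschitz because their partial derivatives are bounded by 1.
\<close>

definition derivative_modulus :: "nat \<Rightarrow> (real \<Rightarrow> real) \<Rightarrow> real \<Rightarrow> real" where
  "derivative_modulus n \<omega> r = \<omega> r + real n * r"

lemma derivative_modulus_mono:
  assumes "modulus_of_continuity \<omega>" "0 < s" "s \<le> t"
  shows "derivative_modulus n \<omega> s \<le> derivative_modulus n \<omega> t"
  unfolding derivative_modulus_def
  using modulus_mono[OF assms] assms(3) by (simp add: add_mono mult_left_mono)

lemma derivative_modulus_pos:
  assumes "modulus_of_continuity \<omega>" "0 < t"
  shows "0 < derivative_modulus n \<omega> t"
  unfolding derivative_modulus_def using modulus_pos[OF assms] assms(2) by (simp add: add_pos_nonneg)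

lemma derivative_modulus_tendsto:
  assumes "modulus_of_continuity \<omega>" "filterlim g (at_right 0) F"
  shows "((\<lambda>x. derivative_modulus n \<omega> (g x)) \<longlongrightarrow> 0) F"
proof -
  have "((\<lambda>r. derivative_modulus n \<omega> r) \<longlongrightarrow> 0 + real n * 0) (at_right 0)"
    unfolding derivative_modulus_def
    using assms(1) by (intro tendsto_intros) (simp add: modulus_of_continuity_def)
  then show ?thesis using filterlim_compose[OF _ assms(2)] by fastforce
qed

lemma iterated_partial_modulus:
  fixes f :: "real^'n \<Rightarrow> real"
  assumes \<omega>: "modulus_of_continuity \<omega>" and f: "f \<in> Cbkw k \<omega>" and "length is \<le> k" "x \<noteq> y"
  shows "\<bar>fold partial is f x - fold partial is f y\<bar> \<le>
    derivative_modulus CARD('n) \<omega> (norm (x - y)) * Cbkw_norm k \<omega> f"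
proof -
  note C = CbkwD(1)[OF \<omega> f] and B = CbkwD(2)[OF \<omega> f, unfolded derivatives_bounded_def]
  let ?N = "Cbkw_norm k \<omega> f"
  have N: "0 \<le> ?N" by (rule Cbkw_norm_nonneg)
  have pos: "0 \<le> ?N * \<omega> (norm (x - y))" "0 \<le> ?N * (CARD('n) * norm (x - y))"
    using N modulus_pos[OF \<omega>, of "norm (x - y)"] assms(4) by simp_all
  show ?thesis
  proof (cases "length is = k")
    case True
    then have "\<bar>fold partial is f x - fold partial is f y\<bar> \<le> ?N * \<omega> (norm (x - y))"
      using B assms(4) by blast
    then show ?thesis using pos by (simp add: derivative_modulus_def algebra_simps)
  next
    case False
    have "\<bar>partial i (fold partial is f) z\<bar> \<le> ?N" for i z
    proof -
      have "length (is @ [i]) \<le> k" using False assms(3) by simp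
      then have "\<bar>fold partial (is @ [i]) f z\<bar> \<le> ?N" using B by blast
      then show ?thesis by simp
    qed
    then have "\<bar>fold partial is f x - fold partial is f y\<bar> \<le> ?N * (CARD('n) * norm (x - y))"
      using partially_differentiable_iterated_partial[OF C] False assms(3)
      by (intro bounded_partials_imp_Lipschitz) auto
    then show ?thesis using pos by (simp add: derivative_modulus_def algebra_simps)
  qed
qed

section \<open>Evaluations of derivatives\<close>

definition deriv_eval ::
  "nat \<Rightarrow> (real \<Rightarrow> real) \<Rightarrow> 'n list \<Rightarrow> real^'n \<Rightarrow> (real^'n \<Rightarrow> real) \<Rightarrow> real" where
  "deriv_eval k \<omega> is x = (\<lambda>f. if f \<in> Cbkw k \<omega> then fold partial is f x else 0)"

lemma deriv_eval_Nil: "deriv_eval k \<omega> [] = point_eval k \<omega>"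
  by (simp add: deriv_eval_def point_eval_def fun_eq_iff)

lemma Gbkw_eq_closed_span:
  assumes "modulus_of_continuity \<omega>"
  shows "Gbkw k \<omega> S = homogeneous_norm.closed_span (Cbkw k \<omega>) (Cbkw_norm k \<omega>) (point_eval k \<omega> ` S)"
  unfolding Gbkw_def homogeneous_norm.closed_span_def[OF homogeneous_norm_Cbkw[OF assms]] ..

context
  fixes k :: nat and \<omega> :: "real \<Rightarrow> real"
  assumes \<omega>: "modulus_of_continuity \<omega>"
begin

interpretation homogeneous_norm "Cbkw k \<omega> :: (real^'n \<Rightarrow> real) set" "Cbkw_norm k \<omega>"
  by (rule homogeneous_norm_Cbkw[OF \<omega>])

lemma deriv_eval_in_dual:
  fixes x :: "real^'n"
  assumes "length is \<le> k"
  shows "deriv_eval k \<omega> is x \<in> Cbkw_dual k \<omega>"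
proof (rule dual_spaceI[where B = 1])
  fix f g :: "real^'n \<Rightarrow> real" assume *: "f \<in> Cbkw k \<omega>" "g \<in> Cbkw k \<omega>"
  then show "deriv_eval k \<omega> is x (f + g) = deriv_eval k \<omega> is x f + deriv_eval k \<omega> is x g"
    using subspace_add[OF subspace_V *] iterated_partial_add[OF CbkwD(1)[OF \<omega>] CbkwD(1)[OF \<omega>] assms]
    by (simp add: deriv_eval_def)
next
  fix f :: "real^'n \<Rightarrow> real" and c :: real assume *: "f \<in> Cbkw k \<omega>"
  then show "deriv_eval k \<omega> is x (c *\<^sub>R f) = c * deriv_eval k \<omega> is x f"
    using subspace_scale[OF subspace_V *] iterated_partial_scaleR[OF CbkwD(1)[OF \<omega>] assms]
    by (simp add: deriv_eval_def scaleR_fun_def)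
qed (use assms CbkwD(2)[OF \<omega>] in \<open>auto simp: deriv_eval_def derivatives_bounded_def\<close>)

lemma dual_norm_deriv_eval:
  fixes x :: "real^'n"
  assumes "length is \<le> k"
  shows "Cbkw_dual_norm k \<omega> (deriv_eval k \<omega> is x) \<le> 1"
  using assms CbkwD(2)[OF \<omega>]
  by (intro dual_norm_le) (auto simp: deriv_eval_def derivatives_bounded_def)

lemma dual_norm_deriv_eval_diff:
  fixes x y :: "real^'n"
  assumes "x \<noteq> y"
  shows "length is \<le> k \<Longrightarrow> Cbkw_dual_norm k \<omega> (deriv_eval k \<omega> is x - deriv_eval k \<omega> is y)
      \<le> derivative_modulus CARD('n) \<omega> (norm (x - y))"
    and "length is = k \<Longrightarrow> Cbkw_dual_norm k \<omega> (deriv_eval k \<omega> is x - deriv_eval k \<omega> is y)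
      \<le> \<omega> (norm (x - y))"
proof -
  assume "length is \<le> k"
  then show "Cbkw_dual_norm k \<omega> (deriv_eval k \<omega> is x - deriv_eval k \<omega> is y)
      \<le> derivative_modulus CARD('n) \<omega> (norm (x - y))"
    using derivative_modulus_pos[OF \<omega>, of "norm (x - y)" "CARD('n)"] assms
    by (intro dual_norm_le) (auto simp: deriv_eval_def intro!: iterated_partial_modulus[OF \<omega>])
next
  assume "length is = k"
  then have "\<bar>fold partial is f x - fold partial is f y\<bar> \<le> \<omega> (norm (x - y)) * Cbkw_norm k \<omega> f"
    if "f \<in> Cbkw k \<omega>" for f
    using CbkwD(2)[OF \<omega> that] assms by (simp add: derivatives_bounded_def mult.commute)
  then show "Cbkw_dual_norm k \<omega> (deriv_eval k \<omega> is x - deriv_eval k \<omega> is y) \<le> \<omega> (norm (x - y))"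
    using modulus_pos[OF \<omega>, of "norm (x - y)"] assms
    by (intro dual_norm_le) (simp_all add: deriv_eval_def)
qed

text \<open>
  By the mean value theorem the difference quotient is the next derivative at a point at distance at
  most \<open>\<bar>t\<bar>\<close> from \<open>x\<close>, so the common modulus bounds the error for all \<open>f\<close> in the unit ball at once.
\<close>

lemma dual_norm_deriv_eval_difference_quotient:
  fixes x :: "real^'n"
  assumes "length is < k" "t \<noteq> 0"
  shows "Cbkw_dual_norm k \<omega> ((1 / t) *\<^sub>R (deriv_eval k \<omega> is (x + t *\<^sub>R axis i 1) - deriv_eval k \<omega> is x)
      - deriv_eval k \<omega> (is @ [i]) x) \<le> derivative_modulus CARD('n) \<omega> \<bar>t\<bar>"
proof (rule dual_norm_le)
  show pos: "0 \<le> derivative_modulus CARD('n) \<omega> \<bar>t\<bar>"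
    using derivative_modulus_pos[OF \<omega>, of "\<bar>t\<bar>" "CARD('n)"] assms(2) by simp
  fix f :: "real^'n \<Rightarrow> real" assume f: "f \<in> Cbkw k \<omega>"
  let ?g = "fold partial is f" and ?N = "Cbkw_norm k \<omega> f"
  obtain s where s: "\<bar>s\<bar> \<le> \<bar>t\<bar>" "?g (x + t *\<^sub>R axis i 1) - ?g x = t * partial i ?g (x + s *\<^sub>R axis i 1)"
    using partial_mean_value[OF partially_differentiable_iterated_partial[OF CbkwD(1)[OF \<omega> f] assms(1)]] .
  have "\<bar>partial i ?g (x + s *\<^sub>R axis i 1) - partial i ?g x\<bar> \<le> derivative_modulus CARD('n) \<omega> \<bar>t\<bar> * ?N"
  proof (cases "s = 0")
    case True
    then show ?thesis using pos Cbkw_norm_nonneg[of k \<omega> f] by simp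
  next
    case False
    then have "x + s *\<^sub>R axis i 1 \<noteq> x" by (simp add: axis_eq_0_iff)
    from iterated_partial_modulus[OF \<omega> f _ this, of "is @ [i]"] assms(1)
    have "\<bar>partial i ?g (x + s *\<^sub>R axis i 1) - partial i ?g x\<bar> \<le> derivative_modulus CARD('n) \<omega> \<bar>s\<bar> * ?N"
      by simp
    also have "\<dots> \<le> derivative_modulus CARD('n) \<omega> \<bar>t\<bar> * ?N"
      using False s(1)
      by (intro mult_right_mono derivative_modulus_mono[OF \<omega>] Cbkw_norm_nonneg) auto
    finally show ?thesis .
  qed
  then show "\<bar>((1 / t) *\<^sub>R (deriv_eval k \<omega> is (x + t *\<^sub>R axis i 1) - deriv_eval k \<omega> is x)
      - deriv_eval k \<omega> (is @ [i]) x) f\<bar> \<le> derivative_modulus CARD('n) \<omega> \<bar>t\<bar> * ?N"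
    using f s(2) assms(2) by (simp add: deriv_eval_def scaleR_fun_def)
qed

lemma closed_subspace_Gbkw:
  "closed_subspace_of (Gbkw k \<omega> S) (Cbkw_dual k \<omega>) (Cbkw_dual_norm k \<omega>)" for S :: "(real^'n) set"
  unfolding Gbkw_eq_closed_span[OF \<omega>]
  by (rule closed_subspace_closed_span)
    (auto simp: deriv_eval_in_dual[of "[]", simplified, unfolded deriv_eval_Nil])

lemma subspace_Gbkw: "subspace (Gbkw k \<omega> S)" for S :: "(real^'n) set"
  using closed_subspace_Gbkw unfolding closed_subspace_of_def by blast

lemma point_eval_in_Gbkw: "x \<in> S \<Longrightarrow> point_eval k \<omega> x \<in> Gbkw k \<omega> S" for S :: "(real^'n) set"
  unfolding Gbkw_def by blast

text \<open>
  A derivative evaluation is a norm limit of difference quotients of evaluations of one order less.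
\<close>

lemma deriv_eval_in_Gbkw:
  fixes x :: "real^'n"
  assumes "length is \<le> k"
  shows "deriv_eval k \<omega> is x \<in> Gbkw k \<omega> UNIV"
  using assms
proof (induction "is" arbitrary: x rule: rev_induct)
  case Nil
  then show ?case by (simp add: deriv_eval_Nil point_eval_in_Gbkw)
next
  case (snoc i "is")
  define t :: "nat \<Rightarrow> real" where "t j = inverse (real (Suc j))" for j
  have t: "t j > 0" for j by (simp add: t_def)
  let ?u = "\<lambda>j. (1 / t j) *\<^sub>R (deriv_eval k \<omega> is (x + t j *\<^sub>R axis i 1) - deriv_eval k \<omega> is x)"
  show ?case
  proof (rule closed_subspace_limit[OF closed_subspace_Gbkw])
    show "deriv_eval k \<omega> (is @ [i]) x \<in> Cbkw_dual k \<omega>"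
      by (rule deriv_eval_in_dual[OF snoc.prems])
    show u: "?u j \<in> Gbkw k \<omega> UNIV" for j
      using snoc by (intro subspace_scale[OF subspace_Gbkw] subspace_diff[OF subspace_Gbkw]) auto
    have "?u j - deriv_eval k \<omega> (is @ [i]) x \<in> Cbkw_dual k \<omega>" for j
      using u[of j] closed_subspace_Gbkw[of UNIV] deriv_eval_in_dual[OF snoc.prems, of x]
      unfolding closed_subspace_of_def by (intro subspace_diff[OF subspace_dual]) blast+
    then have "0 \<le> Cbkw_dual_norm k \<omega> (?u j - deriv_eval k \<omega> (is @ [i]) x)" for j
      by (rule dual_norm_nonneg)
    then have "norm (Cbkw_dual_norm k \<omega> (?u j - deriv_eval k \<omega> (is @ [i]) x))
        \<le> derivative_modulus CARD('n) \<omega> (t j)" for j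
      using dual_norm_deriv_eval_difference_quotient[of "is" "t j" x i] snoc.prems t[of j]
      by (simp only: real_norm_def abs_of_nonneg) simp
    moreover have "filterlim t (at_right 0) sequentially"
      using LIMSEQ_inverse_real_of_nat t unfolding t_def filterlim_at by auto
    ultimately show "(\<lambda>j. Cbkw_dual_norm k \<omega> (?u j - deriv_eval k \<omega> (is @ [i]) x)) \<longlonglongrightarrow> 0"
      by (intro Lim_null_comparison[OF _ derivative_modulus_tendsto[OF \<omega>, where n = "CARD('n)"]]) auto
  qed
qed

text \<open>
  With \<open>F is x = H (deriv_eval k \<omega> is x)\<close>, continuity of \<open>H\<close> turns norm convergence of the difference
  quotients of evaluations into differentiability of \<open>F is\<close> with partial derivatives \<open>F (is @ [i])\<close>,
  and norm bounds on evaluations into bounds on \<open>F is\<close>. So the iterated derivatives of \<open>F []\<close> are the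
  functions \<open>F is\<close>, and all of them satisfy the bounds of the space.
\<close>

lemma Gbkw_dual_imp_Cbkw:
  fixes H :: "((real^'n \<Rightarrow> real) \<Rightarrow> real) \<Rightarrow> real"
  assumes H: "H \<in> dual_space (Gbkw k \<omega> UNIV) (Cbkw_dual_norm k \<omega>)"
  shows "(\<lambda>x. H (point_eval k \<omega> x)) \<in> Cbkw k \<omega>"
proof -
  let ?G = "Gbkw k \<omega> UNIV :: ((real^'n \<Rightarrow> real) \<Rightarrow> real) set" and ?dn = "Cbkw_dual_norm k \<omega>"
  have G_dual: "v \<in> Cbkw_dual k \<omega>" if "v \<in> ?G" for v
    using closed_subspace_Gbkw that unfolding closed_subspace_of_def by blast
  obtain B where B: "0 \<le> B" "\<And>v. v \<in> ?G \<Longrightarrow> \<bar>H v\<bar> \<le> B * ?dn v"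
    using dual_space_bound[OF H] dual_norm_nonneg[OF G_dual] by blast
  define F where "F is x = H (deriv_eval k \<omega> is x)" for "is" x
  have F_diff: "\<bar>F is x - F is y\<bar> \<le> B * ?dn (deriv_eval k \<omega> is x - deriv_eval k \<omega> is y)"
    if "length is \<le> k" for "is" x y
    using B(2)[OF subspace_diff[OF subspace_Gbkw deriv_eval_in_Gbkw[OF that] deriv_eval_in_Gbkw[OF that]]]
      dual_space_diff[OF H subspace_Gbkw deriv_eval_in_Gbkw[OF that] deriv_eval_in_Gbkw[OF that]]
    by (simp add: F_def)
  have F_cont: "continuous_on UNIV (F is)" if len: "length is \<le> k" for "is"
  proof -
    have "(F is \<longlongrightarrow> F is y) (at y)" for y
    proof -
      have "\<forall>\<^sub>F x in at y. norm (F is x - F is y) \<le> B * derivative_modulus CARD('n) \<omega> (norm (x - y))"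
        unfolding eventually_at_filter
      proof (intro always_eventually allI impI)
        fix x assume "x \<noteq> y"
        then show "norm (F is x - F is y) \<le> B * derivative_modulus CARD('n) \<omega> (norm (x - y))"
          using F_diff[OF len, of x y] mult_left_mono[OF dual_norm_deriv_eval_diff(1)[OF _ len] B(1)]
          by fastforce
      qed
      moreover have "filterlim (\<lambda>x. norm (x - y)) (at_right 0) (at y)"
        unfolding filterlim_at
      proof
        show "((\<lambda>x. norm (x - y)) \<longlongrightarrow> 0) (at y)"
          by (intro tendsto_norm_zero LIM_zero tendsto_ident_at)
        show "\<forall>\<^sub>F x in at y. norm (x - y) \<in> {0<..} \<and> norm (x - y) \<noteq> 0"
          by (simp add: eventually_at_filter)
      qed
      then have "((\<lambda>x. B * derivative_modulus CARD('n) \<omega> (norm (x - y))) \<longlongrightarrow> 0) (at y)"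
        by (intro tendsto_mult_right_zero derivative_modulus_tendsto[OF \<omega>])
      ultimately have "((\<lambda>x. F is x - F is y) \<longlongrightarrow> 0) (at y)"
        by (rule Lim_null_comparison)
      then show ?thesis by (rule LIM_zero_cancel)
    qed
    then show ?thesis by (simp add: continuous_on_def)
  qed
  have F_deriv: "((\<lambda>t. F is (x + t *\<^sub>R axis i 1)) has_real_derivative F (is @ [i]) x) (at 0)"
    if len: "length is < k" for "is" x i
  proof -
    let ?q = "\<lambda>t. (1 / t) *\<^sub>R (deriv_eval k \<omega> is (x + t *\<^sub>R axis i 1) - deriv_eval k \<omega> is x)"
    let ?d = "deriv_eval k \<omega> (is @ [i]) x"
    have G: "deriv_eval k \<omega> is z \<in> ?G" "?d \<in> ?G" "?q t \<in> ?G" for z t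
      using len by (auto intro!: deriv_eval_in_Gbkw subspace_scale[OF subspace_Gbkw] subspace_diff[OF subspace_Gbkw])
    have Hq: "H (?q t - ?d) = (F is (x + t *\<^sub>R axis i 1) - F is x) / t - F (is @ [i]) x" for t
    proof -
      have "H (?q t) = (1 / t) * H (deriv_eval k \<omega> is (x + t *\<^sub>R axis i 1) - deriv_eval k \<omega> is x)"
        by (rule dual_spaceD(2)[OF H]) (intro subspace_diff[OF subspace_Gbkw] G)
      then show ?thesis
        unfolding dual_space_diff[OF H subspace_Gbkw G(3,2)] F_def
        by (simp add: dual_space_diff[OF H subspace_Gbkw G(1,1)])
    qed
    have "\<forall>\<^sub>F t in at 0. norm ((F is (x + t *\<^sub>R axis i 1) - F is x) / t - F (is @ [i]) x)
        \<le> B * derivative_modulus CARD('n) \<omega> \<bar>t\<bar>"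
      unfolding eventually_at_filter
    proof (intro always_eventually allI impI)
      fix t :: real assume "t \<noteq> 0"
      have "\<bar>H (?q t - ?d)\<bar> \<le> B * ?dn (?q t - ?d)"
        by (rule B(2)[OF subspace_diff[OF subspace_Gbkw G(3,2)]])
      also have "\<dots> \<le> B * derivative_modulus CARD('n) \<omega> \<bar>t\<bar>"
        by (intro mult_left_mono dual_norm_deriv_eval_difference_quotient len \<open>t \<noteq> 0\<close> B(1))
      finally show "norm ((F is (x + t *\<^sub>R axis i 1) - F is x) / t - F (is @ [i]) x)
        \<le> B * derivative_modulus CARD('n) \<omega> \<bar>t\<bar>" unfolding Hq by simp
    qed
    moreover have "filterlim (\<lambda>t::real. \<bar>t\<bar>) (at_right 0) (at 0)"
      unfolding filterlim_at
    proof
      show "((\<lambda>t::real. \<bar>t\<bar>) \<longlongrightarrow> 0) (at 0)"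
        by (intro tendsto_rabs_zero tendsto_ident_at)
      show "\<forall>\<^sub>F t::real in at 0. \<bar>t\<bar> \<in> {0<..} \<and> \<bar>t\<bar> \<noteq> 0"
        by (simp add: eventually_at_filter)
    qed
    then have "((\<lambda>t. B * derivative_modulus CARD('n) \<omega> \<bar>t\<bar>) \<longlongrightarrow> 0) (at 0)"
      by (intro tendsto_mult_right_zero derivative_modulus_tendsto[OF \<omega>])
    ultimately have "((\<lambda>t. (F is (x + t *\<^sub>R axis i 1) - F is x) / t - F (is @ [i]) x) \<longlongrightarrow> 0) (at 0)"
      by (rule Lim_null_comparison)
    then have "((\<lambda>t. (F is (x + t *\<^sub>R axis i 1) - F is x) / t) \<longlongrightarrow> F (is @ [i]) x) (at 0)"
      by (rule LIM_zero_cancel)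
    then show ?thesis by (simp add: DERIV_def)
  qed
  note F_partial = partially_differentiableI[of "F is" i "F (is @ [i])" for "is" i, OF F_deriv]
  have F_Ck: "Ck m (F is)" if "length is + m \<le> k" for m "is"
    using that
  proof (induction m arbitrary: "is")
    case 0
    then show ?case by (simp add: F_cont)
  next
    case (Suc m)
    then have len: "length is < k" by simp
    show ?case
      unfolding Ck_Suc_iff F_partial(2)[OF len]
      using Suc F_cont F_partial(1)[OF len] by simp
  qed
  have F_fold: "fold partial js (F is) = F (is @ js)" if "length is + length js \<le> k" for "is" js
    using that
  proof (induction js arbitrary: "is")
    case (Cons j js)
    then have "length is < k" by simp
    from F_partial(2)[OF this] Cons show ?case by simp
  qed simp
  have "derivatives_bounded k \<omega> B (F [])"
    unfolding derivatives_bounded_def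
  proof (intro conjI allI impI)
    fix "is" :: "'n list" and x assume len: "length is \<le> k"
    have "\<bar>F is x\<bar> \<le> B * ?dn (deriv_eval k \<omega> is x)"
      unfolding F_def by (rule B(2)[OF deriv_eval_in_Gbkw[OF len]])
    also have "\<dots> \<le> B * 1"
      by (intro mult_left_mono dual_norm_deriv_eval len B(1))
    finally show "\<bar>fold partial is (F []) x\<bar> \<le> B" using F_fold[of "[]"] len by simp
  next
    fix "is" :: "'n list" and x y :: "real^'n" assume len: "length is = k" and "x \<noteq> y"
    have "\<bar>F is x - F is y\<bar> \<le> B * ?dn (deriv_eval k \<omega> is x - deriv_eval k \<omega> is y)"
      using F_diff len by simp
    also have "\<dots> \<le> B * \<omega> (norm (x - y))"
      by (intro mult_left_mono dual_norm_deriv_eval_diff(2) len \<open>x \<noteq> y\<close> B(1))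
    finally show "\<bar>fold partial is (F []) x - fold partial is (F []) y\<bar> \<le> B * \<omega> (norm (x - y))"
      using F_fold[of "[]"] len by simp
  qed
  then have "F [] \<in> Cbkw k \<omega>"
    using CbkwI(1)[OF \<omega> F_Ck] by simp
  then show ?thesis by (simp add: F_def[abs_def] deriv_eval_Nil)
qed

end

section \<open>Extension operators and projections\<close>

lemma restrict0_apply: "x \<in> S \<Longrightarrow> restrict0 S f x = f x"
  by (simp add: restrict0_def)

text \<open>Restriction does not increase the norm, because the norm on \<open>S\<close> is a quotient norm.\<close>

lemma extension_comp_restriction_bounded:
  fixes S :: "(real^'n) set"
  assumes \<omega>: "modulus_of_continuity \<omega>" and T: "T \<in> Ext k \<omega> S"
  shows "bounded_linear_between (Cbkw k \<omega>) (Cbkw_norm k \<omega>) (Cbkw k \<omega>) (Cbkw_norm k \<omega>)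
    (\<lambda>f. T (restrict0 S f))"
proof -
  let ?V = "Cbkw k \<omega> :: (real^'n \<Rightarrow> real) set" and ?N = "Cbkw_norm k \<omega> :: (real^'n \<Rightarrow> real) \<Rightarrow> real"
  have on: "restrict0 S f \<in> Cbkw_on k \<omega> S" if "f \<in> ?V" for f
    using that by (simp add: Cbkw_on_def)
  have add: "restrict0 S (f + g) = restrict0 S f + restrict0 S g" for f g :: "real^'n \<Rightarrow> real"
    by (auto simp: restrict0_def)
  have scale: "restrict0 S (c *\<^sub>R f) = c *\<^sub>R restrict0 S f" for c and f :: "real^'n \<Rightarrow> real"
    by (auto simp: restrict0_def scaleR_fun_def)
  have quotient: "0 \<le> Cbkw_on_norm k \<omega> S (restrict0 S f)" "Cbkw_on_norm k \<omega> S (restrict0 S f) \<le> ?N f"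
    if "f \<in> ?V" for f
  proof -
    let ?A = "{?N h | h. h \<in> ?V \<and> restrict0 S h = restrict0 S f}"
    have "?N f \<in> ?A" using that by blast
    moreover have "0 \<le> a" if "a \<in> ?A" for a using that Cbkw_norm_nonneg by blast
    ultimately show "0 \<le> Cbkw_on_norm k \<omega> S (restrict0 S f)" "Cbkw_on_norm k \<omega> S (restrict0 S f) \<le> ?N f"
      unfolding Cbkw_on_norm_def by (intro cInf_greatest cInf_lower bdd_belowI[of _ 0]; blast)+
  qed
  have Tb: "bounded_linear_between (Cbkw_on k \<omega> S) (Cbkw_on_norm k \<omega> S) ?V ?N T"
    using T by (simp add: Ext_def)
  then obtain B where B: "\<And>g. g \<in> Cbkw_on k \<omega> S \<Longrightarrow> ?N (T g) \<le> B * Cbkw_on_norm k \<omega> S g"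
    unfolding bounded_linear_between_def by blast
  have "?N (T (restrict0 S f)) \<le> \<bar>B\<bar> * ?N f" if f: "f \<in> ?V" for f
  proof -
    have "?N (T (restrict0 S f)) \<le> B * Cbkw_on_norm k \<omega> S (restrict0 S f)"
      by (rule B[OF on[OF f]])
    also have "\<dots> \<le> \<bar>B\<bar> * Cbkw_on_norm k \<omega> S (restrict0 S f)"
      by (rule mult_right_mono) (use quotient[OF f] in auto)
    also have "\<dots> \<le> \<bar>B\<bar> * ?N f"
      by (rule mult_left_mono) (use quotient[OF f] in auto)
    finally show ?thesis .
  qed
  then show ?thesis
    using Tb on unfolding bounded_linear_between_def add scale by blast
qed

theorem theorem1p6:
  fixes k :: nat and \<omega> :: "real \<Rightarrow> real" and S :: "(real^'n) set"
    and T :: "(real^'n \<Rightarrow> real) \<Rightarrow> (real^'n \<Rightarrow> real)"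
  assumes "modulus_of_continuity \<omega>"
    and "closed S"
    and "T \<in> Ext k \<omega> S"
    and "finite_depth k \<omega> S T"
  shows "\<exists>P. bounded_linear_projection_onto (Gbkw k \<omega> UNIV) (Gbkw k \<omega> S) (Cbkw_dual_norm k \<omega>) P \<and>
           (\<forall>h\<in>dual_space (Gbkw k \<omega> S) (Cbkw_dual_norm k \<omega>).
              Gbkw_dual_to_fun k \<omega> UNIV (adjoint_on (Gbkw k \<omega> UNIV) P h) =
              T (Gbkw_dual_to_fun k \<omega> S h))"
proof -
  note \<omega> = assms(1)
  let ?V = "Cbkw k \<omega> :: (real^'n \<Rightarrow> real) set"
  let ?\<delta> = "point_eval k \<omega> :: real^'n \<Rightarrow> _"
  let ?G = "Gbkw k \<omega> UNIV :: ((real^'n \<Rightarrow> real) \<Rightarrow> real) set"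
  interpret homogeneous_norm ?V "Cbkw_norm k \<omega>"
    by (rule homogeneous_norm_Cbkw[OF \<omega>])
  define P where "P = adjoint_on ?V (\<lambda>f. T (restrict0 S f))"
  obtain d where "has_depth k \<omega> S T d"
    using assms(4) unfolding finite_depth_def by blast
  then obtain c y where cy: "\<forall>x. \<forall>i\<in>{1..d}. y x i \<in> S"
      "\<forall>x. \<forall>f\<in>Cbkw_on k \<omega> S. T f x = (\<Sum>i=1..d. c x i * f (y x i))"
    unfolding has_depth_def by (elim exE conjE)
  have y: "y x i \<in> S" if "i \<in> {1..d}" for x i
    using cy(1) that by blast
  have depth: "T f x = (\<Sum>i=1..d. c x i * f (y x i))" if "f \<in> Cbkw_on k \<omega> S" for x f
    using cy(2) that by blast
  have T_ext: "T (restrict0 S f) \<in> ?V" "restrict0 S (T (restrict0 S f)) = restrict0 S f" if "f \<in> ?V" for f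
    using assms(3) that unfolding Ext_def bounded_linear_between_def Cbkw_on_def by auto
  have sum_apply: "(\<Sum>i\<in>I. a i *\<^sub>R v i) f = (\<Sum>i\<in>I. a i * v i f)"
    for I :: "nat set" and a :: "nat \<Rightarrow> real" and v and f :: "real^'n \<Rightarrow> real"
    by (induction I rule: infinite_finite_induct) (simp_all add: scaleR_fun_def)
  have P_\<delta>: "P (?\<delta> x) = (\<Sum>i=1..d. c x i *\<^sub>R ?\<delta> (y x i))" for x
  proof
    fix f
    show "P (?\<delta> x) f = (\<Sum>i=1..d. c x i *\<^sub>R ?\<delta> (y x i)) f"
    proof (cases "f \<in> ?V")
      case True
      then have "P (?\<delta> x) f = (\<Sum>i=1..d. c x i * restrict0 S f (y x i))"
        by (simp add: P_def adjoint_on_def point_eval_def T_ext(1) depth Cbkw_on_def)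
      also have "\<dots> = (\<Sum>i=1..d. c x i * ?\<delta> (y x i) f)"
        using True y by (intro sum.cong) (auto simp: restrict0_apply point_eval_def)
      finally show ?thesis by (simp only: sum_apply)
    qed (simp add: sum_apply P_def adjoint_on_def point_eval_def)
  qed
  have P_\<delta>_S: "P (?\<delta> s) = ?\<delta> s" if "s \<in> S" for s
  proof
    fix f
    show "P (?\<delta> s) f = ?\<delta> s f"
      using fun_cong[OF T_ext(2)[of f], of s] T_ext(1)[of f] that
      by (simp add: P_def adjoint_on_def point_eval_def restrict0_apply)
  qed
  have proj: "bounded_linear_projection_onto ?G (Gbkw k \<omega> S) (Cbkw_dual_norm k \<omega>) P"
    unfolding P_def Gbkw_eq_closed_span[OF \<omega>]
  proof (rule adjoint_projection[OF extension_comp_restriction_bounded[OF \<omega> assms(3)]], fold P_def)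
    show "range ?\<delta> \<subseteq> Cbkw_dual k \<omega>"
      using deriv_eval_in_dual[OF \<omega>, of "[]"] by (auto simp: deriv_eval_Nil)
    show "P \<phi> \<in> closed_span (?\<delta> ` S)" if "\<phi> \<in> range ?\<delta>" for \<phi>
      unfolding Gbkw_eq_closed_span[OF \<omega>, symmetric]
      using that y by (auto simp: P_\<delta> intro!: subspace_sum subspace_scale subspace_Gbkw[OF \<omega>] point_eval_in_Gbkw[OF \<omega>])
  qed (auto simp: P_\<delta>_S)
  show ?thesis
  proof (intro exI[of _ P] conjI proj ballI)
    fix h assume h: "h \<in> dual_space (Gbkw k \<omega> S) (Cbkw_dual_norm k \<omega>)"
    define F where "F x = h (P (?\<delta> x))" for x
    have F_eq: "Gbkw_dual_to_fun k \<omega> UNIV (adjoint_on ?G P h) = F"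
      by (simp add: fun_eq_iff Gbkw_dual_to_fun_def restrict0_def adjoint_on_def F_def
          point_eval_in_Gbkw[OF \<omega>])
    have P_lin: "bounded_linear_between ?G (Cbkw_dual_norm k \<omega>) (Gbkw k \<omega> S) (Cbkw_dual_norm k \<omega>) P"
      using proj by (simp add: bounded_linear_projection_onto_def)
    have G_dual: "Gbkw k \<omega> S' \<subseteq> Cbkw_dual k \<omega>" for S' :: "(real^'n) set"
      using closed_subspace_Gbkw[OF \<omega>, of k S'] unfolding closed_subspace_of_def by (rule conjunct1)
    have "adjoint_on ?G P h \<in> dual_space ?G (Cbkw_dual_norm k \<omega>)"
    proof -
      obtain B where B: "0 \<le> B" "\<And>v. v \<in> Gbkw k \<omega> S \<Longrightarrow> \<bar>h v\<bar> \<le> B * Cbkw_dual_norm k \<omega> v"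
        using dual_space_bound[OF h] dual_norm_nonneg G_dual by blast
      obtain C where C: "\<And>v. v \<in> ?G \<Longrightarrow> Cbkw_dual_norm k \<omega> (P v) \<le> C * Cbkw_dual_norm k \<omega> v"
        using P_lin unfolding bounded_linear_between_def by blast
      have PG: "P v \<in> Gbkw k \<omega> S" if "v \<in> ?G" for v
        using P_lin that unfolding bounded_linear_between_def by blast
      show ?thesis
      proof (rule dual_spaceI[where B = "B * C"])
        fix v assume v: "v \<in> ?G"
        have "\<bar>h (P v)\<bar> \<le> B * Cbkw_dual_norm k \<omega> (P v)" by (rule B(2)[OF PG[OF v]])
        also have "\<dots> \<le> B * (C * Cbkw_dual_norm k \<omega> v)" by (rule mult_left_mono[OF C[OF v] B(1)])
        finally show "\<bar>adjoint_on ?G P h v\<bar> \<le> B * C * Cbkw_dual_norm k \<omega> v"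
          using v by (simp add: adjoint_on_def mult.assoc)
      next
        fix u v assume *: "u \<in> ?G" "v \<in> ?G"
        then have "P (u + v) = P u + P v" "u + v \<in> ?G"
          using P_lin subspace_add[OF subspace_Gbkw[OF \<omega>]] unfolding bounded_linear_between_def by auto
        then show "adjoint_on ?G P h (u + v) = adjoint_on ?G P h u + adjoint_on ?G P h v"
          using * by (simp add: adjoint_on_def dual_spaceD(1)[OF h] PG)
      next
        fix a v assume *: "v \<in> ?G"
        then have "P (a *\<^sub>R v) = a *\<^sub>R P v" "a *\<^sub>R v \<in> ?G"
          using P_lin subspace_scale[OF subspace_Gbkw[OF \<omega>]] unfolding bounded_linear_between_def by auto
        then show "adjoint_on ?G P h (a *\<^sub>R v) = a * adjoint_on ?G P h v"
          using * by (simp add: adjoint_on_def dual_spaceD(2)[OF h] PG)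
      qed (simp add: adjoint_on_def)
    qed
    \<comment> \<open>\<open>F\<close> agrees on \<open>S\<close> with the function represented by \<open>h\<close>, which is therefore in the domain of \<open>T\<close>;
      only then does the depth formula apply to it.\<close>
    from Gbkw_dual_imp_Cbkw[OF \<omega> this] have F: "F \<in> ?V"
      by (simp add: adjoint_on_def point_eval_in_Gbkw[OF \<omega>] F_def[abs_def])
    have "restrict0 S F = Gbkw_dual_to_fun k \<omega> S h"
      by (auto simp: fun_eq_iff restrict0_def Gbkw_dual_to_fun_def F_def P_\<delta>_S)
    then have "Gbkw_dual_to_fun k \<omega> S h \<in> Cbkw_on k \<omega> S"
      unfolding Cbkw_on_def by (rule image_eqI[OF sym F])
    then have T_eq: "T (Gbkw_dual_to_fun k \<omega> S h) x =
        (\<Sum>i=1..d. c x i * Gbkw_dual_to_fun k \<omega> S h (y x i))" for x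
      by (rule depth)
    have "F x = T (Gbkw_dual_to_fun k \<omega> S h) x" for x
    proof -
      have "F x = (\<Sum>i=1..d. c x i * h (?\<delta> (y x i)))"
        unfolding F_def P_\<delta>
        by (rule dual_space_sum[OF h subspace_Gbkw[OF \<omega>]]) (rule point_eval_in_Gbkw[OF \<omega> y])
      also have "\<dots> = (\<Sum>i=1..d. c x i * Gbkw_dual_to_fun k \<omega> S h (y x i))"
        unfolding Gbkw_dual_to_fun_def
        by (rule sum.cong[OF refl]) (simp only: restrict0_apply[OF y])
      finally show ?thesis unfolding T_eq .
    qed
    then show "Gbkw_dual_to_fun k \<omega> UNIV (adjoint_on ?G P h) = T (Gbkw_dual_to_fun k \<omega> S h)"
      unfolding F_eq by auto
  qed
qed

end
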